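(* Let $X=\{P_1,\dots,P_r\}\subseteq\mathbb P^n_{\mathbf k}\setminus\{x_n=0\}$ be an arithmetically Gorenstein set of $r$ distinct points, not contained in a hyperplane, of socle degree $s$, and let $L_1,\dots,L_r$ be the associated linear forms, normalized so that the coefficient of $y_n$ in each $L_i$ is $1$. Let $B=R/J$ be an Artinian Gorenstein graded $\mathbf k$-algebra of length $r$ and socle degree $s$, and let $J^\perp=\langle F\rangle$ with $F\in\Gamma$ a homogeneous form of degree $s$. The following conditions are equivalent: (1) $B$ is the Artinian reduction of $X$ with respect to $x_n$, i.e. $J=I(X)+(x_n)$; (2) there exist $\alpha_1,\dots,\alpha_r\in\mathbf k^*$ (unique up to scalars) such that $F=\sum_{i=1}^r\alpha_iL_i^{s}$ and $\sum_{i=1}^r\alpha_iL_i^{s-1}=0$.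
   Context: $\mathbf k$ is an algebraically closed field of characteristic zero, $n\ge1$, $R=\mathbf k[x_0,\dots,x_n]$ (standard graded) and $\Gamma=\mathbf k[y_0,\dots,y_n]$. $R$ acts on $\Gamma$ by differentiation: $f\circ g=f(\partial_{y_0},\dots,\partial_{y_n})(g)$. $\langle F\rangle$ denotes the $R$-submodule of $\Gamma$ generated by $F$. For an ideal $I\subset R$, $I^\perp=\{G\in\Gamma: I\circ G=0\}$. $I(X)\subset R$ is the homogeneous ideal of all forms vanishing on $X$. $X$ is arithmetically Gorenstein if $R/I(X)$ is a Gorenstein ring. With $\mathrm{HF}_X(t)=\dim_{\mathbf k}(R/I(X))_t$, the socle degree of $X$ is the largest $t$ with $\mathrm{HF}_X(t)-\mathrm{HF}_X(t-1)\ne0$, equivalently the least $t$ with $\mathrm{HF}_X(t)=r$. For an Artinian Gorenstein graded algebra $B$, the socle degree is the largest $t$ with $B_t\neq0$. The linear form associated to $P=[a_0,\dots,a_n]$ is $L=a_0y_0+\cdots+a_ny_n\in\Gamma$; for points off $\{x_n=0\}$ the representatives are chosen with $a_n=1$. *)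

theory Defs
  imports
    "HOL-Library.Cardinality"
    "HOL-Library.Poly_Mapping"
    "HOL-Computational_Algebra.Polynomial"
    "HOL-Algebra.QuotRing"
    "HOL-Algebra.Module"
    "HOL-Algebra.Ring_Divisibility"
    "HOL-Algebra.Algebraic_Closure_Type"
begin

section \<open>Gorenstein rings\<close>

text \<open>The fraction \<open>a/s\<close> in the localization at the prime \<open>P\<close>, as an equivalence class of
  pairs (numerator, denominator).\<close>

definition loc_frac :: "('a, 'm) ring_scheme \<Rightarrow> 'a set \<Rightarrow> 'a \<Rightarrow> 'a \<Rightarrow> ('a \<times> 'a) set" where
  "loc_frac A P a s =
     {(b, t). b \<in> carrier A \<and> t \<in> carrier A - P \<and>
        (\<exists>u \<in> carrier A - P. u \<otimes>\<^bsub>A\<^esub> (a \<otimes>\<^bsub>A\<^esub> t) = u \<otimes>\<^bsub>A\<^esub> (b \<otimes>\<^bsub>A\<^esub> s))}"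

text \<open>The unions below range over representatives, and all the united classes coincide.\<close>

definition localization :: "('a, 'm) ring_scheme \<Rightarrow> 'a set \<Rightarrow> ('a \<times> 'a) set ring" where
  "localization A P =
     \<lparr>carrier = {loc_frac A P a s | a s. a \<in> carrier A \<and> s \<in> carrier A - P},
      monoid.mult = (\<lambda>x y. \<Union>(a, s)\<in>x. \<Union>(b, t)\<in>y. loc_frac A P (a \<otimes>\<^bsub>A\<^esub> b) (s \<otimes>\<^bsub>A\<^esub> t)),
      one = loc_frac A P \<one>\<^bsub>A\<^esub> \<one>\<^bsub>A\<^esub>,
      zero = loc_frac A P \<zero>\<^bsub>A\<^esub> \<one>\<^bsub>A\<^esub>,
      add = (\<lambda>x y. \<Union>(a, s)\<in>x. \<Union>(b, t)\<in>y.
               loc_frac A P (a \<otimes>\<^bsub>A\<^esub> t \<oplus>\<^bsub>A\<^esub> b \<otimes>\<^bsub>A\<^esub> s) (s \<otimes>\<^bsub>A\<^esub> t))\<rparr>"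

definition self_module :: "'a ring \<Rightarrow> ('a, 'a) module" where
  "self_module A =
     \<lparr>carrier = carrier A, monoid.mult = monoid.mult A, one = \<one>\<^bsub>A\<^esub>, zero = \<zero>\<^bsub>A\<^esub>, add = add A,
      module.smult = monoid.mult A\<rparr>"

definition mod_hom :: "'a ring \<Rightarrow> ('a, 'b) module \<Rightarrow> ('a, 'c) module \<Rightarrow> ('b \<Rightarrow> 'c) set" where
  "mod_hom A M N =
     {f \<in> carrier M \<rightarrow> carrier N.
        (\<forall>x\<in>carrier M. \<forall>y\<in>carrier M. f (x \<oplus>\<^bsub>M\<^esub> y) = f x \<oplus>\<^bsub>N\<^esub> f y) \<and>
        (\<forall>a\<in>carrier A. \<forall>x\<in>carrier M. f (a \<odot>\<^bsub>M\<^esub> x) = a \<odot>\<^bsub>N\<^esub> f x)}"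

definition mod_ker :: "('a, 'b) module \<Rightarrow> ('a, 'c) module \<Rightarrow> ('b \<Rightarrow> 'c) \<Rightarrow> 'b set" where
  "mod_ker M N f = {x \<in> carrier M. f x = \<zero>\<^bsub>N\<^esub>}"

text \<open>HOL cannot quantify over all modules \<open>M\<close>, only over those carried by a fixed type. The type of
  the elements of \<open>A\<close> is large enough: it carries \<open>A\<close> itself with its ideals as submodules, so by
  Baer's criterion the extension property below implies the one for arbitrary modules.\<close>

definition injective_module :: "'a ring \<Rightarrow> ('a, 'b) module \<Rightarrow> bool" where
  "injective_module A E \<longleftrightarrow> module A E \<and>
     (\<forall>(M :: ('a, 'a) module) N. \<forall>f \<in> mod_hom A (M\<lparr>carrier := N\<rparr>) E.
        module A M \<and> submodule N A M \<longrightarrow> (\<exists>g \<in> mod_hom A M E. \<forall>x\<in>N. g x = f x))"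

text \<open>Existence of an injective resolution \<open>0 \<rightarrow> M \<rightarrow> E\<^sub>0 \<rightarrow> E\<^sub>1 \<rightarrow> \<dots>\<close> that vanishes in large degrees.
  The terms are carried by \<^typ>\<open>'a list\<close>. For \<open>A\<close> Noetherian and \<open>M\<close> finitely generated this is no
  restriction: the terms of the minimal injective resolution are direct sums of copies of the
  injective hulls \<open>E(A/p)\<close> with finite multiplicities, of cardinality at most
  \<open>max(|A|, \<aleph>\<^sub>0)\<close>.\<close>

definition finite_injective_dim :: "'a ring \<Rightarrow> ('a, 'b) module \<Rightarrow> bool" where
  "finite_injective_dim A M \<longleftrightarrow>
     (\<exists>(E :: nat \<Rightarrow> ('a, 'a list) module) \<eta> \<delta> d.
        (\<forall>i. injective_module A (E i)) \<and>
        (\<forall>i>d. carrier (E i) = {\<zero>\<^bsub>E i\<^esub>}) \<and>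
        \<eta> \<in> mod_hom A M (E 0) \<and> inj_on \<eta> (carrier M) \<and>
        (\<forall>i. \<delta> i \<in> mod_hom A (E i) (E (Suc i))) \<and>
        \<eta> ` carrier M = mod_ker (E 0) (E 1) (\<delta> 0) \<and>
        (\<forall>i. \<delta> i ` carrier (E i) = mod_ker (E (Suc i)) (E (Suc (Suc i))) (\<delta> (Suc i))))"

definition gorenstein_ring :: "'a ring \<Rightarrow> bool" where
  "gorenstein_ring A \<longleftrightarrow> cring A \<and> noetherian_ring A \<and>
     (\<forall>P. primeideal P A \<longrightarrow>
        finite_injective_dim (localization A P) (self_module (localization A P)))"

definition artinian_ring :: "'a ring \<Rightarrow> bool" where
  "artinian_ring A \<longleftrightarrow> cring A \<and>
     (\<forall>I :: nat \<Rightarrow> 'a set. (\<forall>i. ideal (I i) A \<and> I (Suc i) \<subseteq> I i) \<longrightarrow> (\<exists>N. \<forall>i\<ge>N. I i = I N))"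

section \<open>Polynomials and graded pieces\<close>

text \<open>Polynomials over \<open>'k\<close> whose variables are indexed by \<open>'v\<close>. For a finite type \<open>'v\<close> with
  \<open>n + 1\<close> elements this is both \<open>R = k[x\<^sub>0,\<dots>,x\<^sub>n]\<close> and \<open>\<Gamma> = k[y\<^sub>0,\<dots>,y\<^sub>n]\<close>.\<close>

type_synonym ('v, 'k) mpoly = "('v \<Rightarrow>\<^sub>0 nat) \<Rightarrow>\<^sub>0 'k"

abbreviation polyring :: "('v, 'k::comm_ring_1) mpoly ring" where
  "polyring \<equiv> ring_of_type_algebra"

definition PConst :: "'k \<Rightarrow> ('v, 'k::comm_ring_1) mpoly" where
  "PConst c = Poly_Mapping.single 0 c"

definition PVar :: "'v \<Rightarrow> ('v, 'k::comm_ring_1) mpoly" where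
  "PVar v = Poly_Mapping.single (Poly_Mapping.single v 1) 1"

definition mon_deg :: "('v::finite \<Rightarrow>\<^sub>0 nat) \<Rightarrow> nat" where
  "mon_deg m = (\<Sum>v\<in>UNIV. Poly_Mapping.lookup m v)"

definition forms :: "nat \<Rightarrow> ('v::finite, 'k::comm_ring_1) mpoly set" where
  "forms d = {p. \<forall>m \<in> Poly_Mapping.keys p. mon_deg m = d}"

definition hom_component :: "nat \<Rightarrow> ('v::finite, 'k::comm_ring_1) mpoly \<Rightarrow> ('v, 'k) mpoly" where
  "hom_component d p =
     (\<Sum>m | m \<in> Poly_Mapping.keys p \<and> mon_deg m = d.
        Poly_Mapping.single m (Poly_Mapping.lookup p m))"

definition homogeneous_ideal :: "('v::finite, 'k::comm_ring_1) mpoly set \<Rightarrow> bool" where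
  "homogeneous_ideal I \<longleftrightarrow> ideal I polyring \<and> (\<forall>f\<in>I. \<forall>d. hom_component d f \<in> I)"

definition eval_at :: "('v::finite, 'k::comm_ring_1) mpoly \<Rightarrow> ('v \<Rightarrow> 'k) \<Rightarrow> 'k" where
  "eval_at p a =
     (\<Sum>m \<in> Poly_Mapping.keys p.
        Poly_Mapping.lookup p m * (\<Prod>v\<in>UNIV. a v ^ Poly_Mapping.lookup m v))"

text \<open>\<open>V/W\<close> has finite \<open>k\<close>-dimension \<open>d\<close>: the classes of the elements of \<open>S\<close> form a basis.\<close>

definition has_quot_dim ::
    "('v::finite, 'k::field) mpoly set \<Rightarrow> ('v, 'k) mpoly set \<Rightarrow> nat \<Rightarrow> bool" where
  "has_quot_dim V W d \<longleftrightarrow>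
     (\<exists>S. finite S \<and> card S = d \<and> S \<subseteq> V \<and>
        (\<forall>c. (\<Sum>b\<in>S. PConst (c b) * b) \<in> W \<longrightarrow> (\<forall>b\<in>S. c b = 0)) \<and>
        (\<forall>p\<in>V. \<exists>c. p - (\<Sum>b\<in>S. PConst (c b) * b) \<in> W))"

definition hilbert_fun :: "('v::finite, 'k::field) mpoly set \<Rightarrow> nat \<Rightarrow> nat" where
  "hilbert_fun I t = (THE d. has_quot_dim (forms t) (I \<inter> forms t) d)"

text \<open>\<open>B\<^sub>t\<close> is the image of \<open>R\<^sub>t\<close> in \<open>B = R/J\<close>, so \<open>B\<^sub>t \<noteq> 0\<close> means that \<open>R\<^sub>t\<close> is not contained in \<open>J\<close>.\<close>

definition algebra_socle_degree :: "('v::finite, 'k::field) mpoly set \<Rightarrow> nat \<Rightarrow> bool" where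
  "algebra_socle_degree J s \<longleftrightarrow> \<not> forms s \<subseteq> J \<and> (\<forall>t>s. forms t \<subseteq> J)"

section \<open>Points\<close>

text \<open>A set of points of projective space is given by a set \<open>Z\<close> of representatives of its
  elements; whether a form vanishes at a point does not depend on the representative.\<close>

definition vanishing_ideal ::
    "('v::finite \<Rightarrow> 'k) set \<Rightarrow> ('v, 'k::field) mpoly set" where
  "vanishing_ideal Z = Idl\<^bsub>polyring\<^esub> {f. (\<exists>d. f \<in> forms d) \<and> (\<forall>a\<in>Z. eval_at f a = 0)}"

definition arithmetically_gorenstein :: "('v::finite \<Rightarrow> 'k::field) set \<Rightarrow> bool" where
  "arithmetically_gorenstein Z \<longleftrightarrow> gorenstein_ring (polyring Quot (vanishing_ideal Z))"

definition in_hyperplane :: "('v::finite \<Rightarrow> 'k::field) set \<Rightarrow> bool" where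
  "in_hyperplane Z \<longleftrightarrow> (\<exists>l \<in> forms 1. l \<noteq> 0 \<and> (\<forall>a\<in>Z. eval_at l a = 0))"

definition hilbert_diff :: "('v::finite \<Rightarrow> 'k::field) set \<Rightarrow> nat \<Rightarrow> int" where
  "hilbert_diff Z t =
     int (hilbert_fun (vanishing_ideal Z) t) -
     (if t = 0 then 0 else int (hilbert_fun (vanishing_ideal Z) (t - 1)))"

definition points_socle_degree :: "('v::finite \<Rightarrow> 'k::field) set \<Rightarrow> nat \<Rightarrow> bool" where
  "points_socle_degree Z s \<longleftrightarrow> hilbert_diff Z s \<noteq> 0 \<and> (\<forall>t>s. hilbert_diff Z t = 0)"

definition lin_form :: "('v::finite \<Rightarrow> 'k) \<Rightarrow> ('v, 'k::field) mpoly" where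
  "lin_form a = (\<Sum>v\<in>UNIV. PConst (a v) * PVar v)"

section \<open>The action by differentiation\<close>

definition pdiff :: "'v \<Rightarrow> ('v::finite, 'k::comm_ring_1) mpoly \<Rightarrow> ('v, 'k) mpoly" where
  "pdiff v g =
     (\<Sum>m \<in> Poly_Mapping.keys g.
        Poly_Mapping.single (m - Poly_Mapping.single v 1)
          (of_nat (Poly_Mapping.lookup m v) * Poly_Mapping.lookup g m))"

text \<open>The composition over all \<open>v\<close> of the operators \<open>\<partial>\<^sub>v ^ m\<^sub>v\<close>; they commute, so the fold is
  independent of the order.\<close>

definition mon_diff :: "('v \<Rightarrow>\<^sub>0 nat) \<Rightarrow> ('v::finite, 'k::comm_ring_1) mpoly \<Rightarrow> ('v, 'k) mpoly" where
  "mon_diff m g = Finite_Set.fold (\<lambda>v. pdiff v ^^ Poly_Mapping.lookup m v) g UNIV"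

definition diff_act ::
    "('v::finite, 'k::comm_ring_1) mpoly \<Rightarrow> ('v, 'k) mpoly \<Rightarrow> ('v, 'k) mpoly" where
  "diff_act f g =
     (\<Sum>m \<in> Poly_Mapping.keys f. PConst (Poly_Mapping.lookup f m) * mon_diff m g)"

definition perp :: "('v::finite, 'k::comm_ring_1) mpoly set \<Rightarrow> ('v, 'k) mpoly set" where
  "perp I = {G. \<forall>f\<in>I. diff_act f G = 0}"

definition gen_submodule :: "('v::finite, 'k::comm_ring_1) mpoly \<Rightarrow> ('v, 'k) mpoly set" where
  "gen_submodule F = {diff_act f F | f. True}"

end

theory Submission
  imports Defs
begin

text \<open>The pairing \<open>apolar f G\<close>, the constant term of \<open>f \<circ> G\<close>, satisfies
  \<open>apolar h (f \<circ> G) = apolar (h f) G\<close> and \<open>apolar f (L\<^sub>P\<^sup>s) = s! f\<^sub>s(P)\<close>, where \<open>f\<^sub>s\<close> is the component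
  of degree \<open>s\<close>. Duality for this pairing gives \<open>J = Ann(F)\<close>. Write \<open>K = I(X) + (x\<^sub>z)\<close>.

  If \<open>F = \<Sum> \<alpha>\<^sub>i L\<^sub>i\<^sup>s\<close> and \<open>\<Sum> \<alpha>\<^sub>i L\<^sub>i\<^sup>s\<^sup>-\<^sup>1 = 0\<close>, then \<open>I(X)\<close> and \<open>x\<^sub>z\<close> annihilate \<open>F\<close>, so \<open>K \<subseteq> J\<close>; as
  \<open>R/K\<close> has length at most \<open>r\<close>, equality follows.

  Conversely, let \<open>J = K\<close>. A form \<open>q = g + x\<^sub>z h\<close> in \<open>K\<close> with \<open>g \<in> I(X)\<close> has the same values on \<open>X\<close> as
  \<open>h\<close>, whose degree is one less. As \<open>K\<close> contains all forms of degree larger than \<open>s\<close>, this descent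
  yields separators \<open>q\<^sub>i\<close> of the points in degree \<open>s\<close>, and \<open>F = \<Sum> \<alpha>\<^sub>i L\<^sub>i\<^sup>s\<close> with
  \<open>s! \<alpha>\<^sub>i = apolar q\<^sub>i F\<close>. If \<open>\<alpha>\<^sub>i = 0\<close>, then all separators of \<open>P\<^sub>i\<close> annihilate \<open>F\<close> and lie in \<open>K\<close>,
  so the descent could be continued below degree 0.\<close>

section \<open>Coefficients and linear functionals on polynomials\<close>

lemma poly_mapping_eq_sum_single:
  "p = (\<Sum>m\<in>Poly_Mapping.keys p. Poly_Mapping.single m (Poly_Mapping.lookup p m))"
  by (rule poly_mapping_eqI)
     (simp add: lookup_sum lookup_single when_def in_keys_iff)

text \<open>Evaluation at a point and the apolarity pairing are both functionals of this kind, so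
  their linearity and their behaviour on products are derived here once.\<close>

definition lin_ext :: "('a \<Rightarrow> 'k::comm_ring_1) \<Rightarrow> ('a \<Rightarrow>\<^sub>0 'k) \<Rightarrow> 'k" where
  "lin_ext w p = (\<Sum>m\<in>Poly_Mapping.keys p. Poly_Mapping.lookup p m * w m)"

lemma lin_ext_superset:
  "finite A \<Longrightarrow> Poly_Mapping.keys p \<subseteq> A \<Longrightarrow> lin_ext w p = (\<Sum>m\<in>A. Poly_Mapping.lookup p m * w m)"
  unfolding lin_ext_def by (rule sum.mono_neutral_left) (auto simp: in_keys_iff)

lemma lin_ext_zero [simp]: "lin_ext w 0 = 0"
  by (simp add: lin_ext_def)

lemma lin_ext_add: "lin_ext w (p + q) = lin_ext w p + lin_ext w q"
proof -
  let ?A = "Poly_Mapping.keys p \<union> Poly_Mapping.keys q"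
  have "lin_ext w u = (\<Sum>m\<in>?A. Poly_Mapping.lookup u m * w m)"
    if "u = p \<or> u = q \<or> u = p + q" for u
    by (rule lin_ext_superset) (use that keys_add[of p q] in auto)
  then show ?thesis
    by (simp add: lookup_add distrib_right sum.distrib)
qed

lemma lin_ext_sum: "lin_ext w (\<Sum>i\<in>A. f i) = (\<Sum>i\<in>A. lin_ext w (f i))"
  by (induction A rule: infinite_finite_induct) (auto simp: lin_ext_add)

lemma lin_ext_single [simp]: "lin_ext w (Poly_Mapping.single m c) = c * w m"
  by (simp add: lin_ext_def)

text \<open>Both factors are expanded into monomials. For evaluation this becomes multiplicativity,
  for the pairing the adjunction \<open>apolar_diff_act\<close>.\<close>

lemma lin_ext_mult:
  fixes p q :: "('a::comm_monoid_add) \<Rightarrow>\<^sub>0 'k::comm_ring_1"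
  shows "lin_ext w (p * q) = lin_ext (\<lambda>m. lin_ext (\<lambda>n. w (m + n)) q) p"
proof -
  have "p * q = (\<Sum>m\<in>Poly_Mapping.keys p. \<Sum>n\<in>Poly_Mapping.keys q.
      Poly_Mapping.single (m + n) (Poly_Mapping.lookup p m * Poly_Mapping.lookup q n))"
    by (subst poly_mapping_eq_sum_single[of p], subst poly_mapping_eq_sum_single[of q])
       (simp add: sum_product mult_single)
  then show ?thesis
    by (simp add: lin_ext_sum) (simp add: lin_ext_def sum_distrib_left mult.assoc)
qed

lemma lookup_PConst_mult [simp]:
  "Poly_Mapping.lookup (PConst c * p) m = c * Poly_Mapping.lookup p m"
  unfolding PConst_def mult_map_scale_conv_mult[symmetric]
  by (simp add: map.rep_eq when_def)

lemma PConst_mult_single [simp]: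
  "PConst c * Poly_Mapping.single m d = Poly_Mapping.single m (c * d)"
  by (simp add: PConst_def mult_single)

lemma lin_ext_PConst_mult [simp]:
  fixes p :: "('v, 'k::comm_ring_1) mpoly"
  shows "lin_ext w (PConst c * p) = c * lin_ext w p"
proof -
  have "Poly_Mapping.keys (PConst c * p) \<subseteq> Poly_Mapping.keys p"
    by (auto simp: in_keys_iff)
  then have "lin_ext w (PConst c * p) = (\<Sum>m\<in>Poly_Mapping.keys p. Poly_Mapping.lookup (PConst c * p) m * w m)"
    by (intro lin_ext_superset) auto
  then show ?thesis by (simp add: lin_ext_def sum_distrib_left mult.assoc)
qed

lemma lin_ext_minus: "lin_ext w (p - q) = lin_ext w p - lin_ext w q"
  using lin_ext_add[of w "p - q" q] by simp

text \<open>Provides bases and the extension of functionals from independent sets, on which the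
  duality in \<open>ideal_eq_annihilator\<close> rests.\<close>

interpretation mpoly: vector_space "\<lambda>c (p :: ('v, 'k::field) mpoly). PConst c * p"
  by unfold_locales
     (auto intro!: poly_mapping_eqI simp: lookup_add distrib_left distrib_right mult.assoc)

lemma lookup_single_mult:
  fixes p :: "('v, 'k::comm_ring_1) mpoly"
  shows "Poly_Mapping.lookup (Poly_Mapping.single k c * p) (k + m) = c * Poly_Mapping.lookup p m"
proof -
  have "Poly_Mapping.single k c * p =
      (\<Sum>n\<in>Poly_Mapping.keys p. Poly_Mapping.single (k + n) (c * Poly_Mapping.lookup p n))"
    by (subst poly_mapping_eq_sum_single[of p]) (simp add: sum_distrib_left mult_single)
  then show ?thesis
    by (simp add: lookup_sum lookup_single when_def in_keys_iff)
qed

subsection \<open>Grading and evaluation\<close>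

lemma mon_deg_add [simp]: "mon_deg (m + n) = mon_deg m + mon_deg n"
  by (simp add: mon_deg_def lookup_add sum.distrib)

lemma mon_deg_zero [simp]: "mon_deg 0 = 0"
  by (simp add: mon_deg_def)

lemma mon_deg_single [simp]: "mon_deg (Poly_Mapping.single v n) = n"
  by (simp add: mon_deg_def lookup_single when_def)

text \<open>Each exponent is bounded by the degree. The polynomial dual to a functional in
  \<open>ideal_eq_annihilator\<close> is a sum over this set.\<close>

lemma finite_mon_deg_le: "finite {m :: 'v::finite \<Rightarrow>\<^sub>0 nat. mon_deg m \<le> s}"
proof -
  have "Poly_Mapping.lookup m v \<le> mon_deg m" for m :: "'v \<Rightarrow>\<^sub>0 nat" and v
    unfolding mon_deg_def by (rule member_le_sum) auto
  then have "Poly_Mapping.lookup ` {m :: 'v \<Rightarrow>\<^sub>0 nat. mon_deg m \<le> s} \<subseteq>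
      {f. \<forall>v. (v \<in> UNIV \<longrightarrow> f v \<in> {..s}) \<and> (v \<notin> UNIV \<longrightarrow> f v = 0)}"
    using order_trans by fastforce
  then have "finite (Poly_Mapping.lookup ` {m :: 'v \<Rightarrow>\<^sub>0 nat. mon_deg m \<le> s})"
    by (rule finite_subset) (rule finite_set_of_finite_funs; simp)
  then show ?thesis
    by (rule finite_imageD) (auto intro: inj_onI poly_mapping_eqI)
qed

lemma forms_iff: "p \<in> forms d \<longleftrightarrow> (\<forall>m. Poly_Mapping.lookup p m \<noteq> 0 \<longrightarrow> mon_deg m = d)"
  by (auto simp: forms_def in_keys_iff)

lemma forms_zero [simp]: "0 \<in> forms d"
  by (simp add: forms_iff)

lemma forms_add: "p \<in> forms d \<Longrightarrow> q \<in> forms d \<Longrightarrow> p + q \<in> forms d"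
  unfolding forms_iff lookup_add by (metis add_0)

lemma forms_minus: "p \<in> forms d \<Longrightarrow> q \<in> forms d \<Longrightarrow> p - q \<in> forms d"
  unfolding forms_iff lookup_minus by (metis diff_self)

lemma forms_sum: "(\<And>i. i \<in> A \<Longrightarrow> f i \<in> forms d) \<Longrightarrow> (\<Sum>i\<in>A. f i) \<in> forms d"
  by (induction A rule: infinite_finite_induct) (auto intro: forms_add)

lemma forms_PConst_mult: "p \<in> forms d \<Longrightarrow> PConst c * p \<in> forms d"
  unfolding forms_iff lookup_PConst_mult by (metis mult_zero_right)

lemma forms_mult: "p \<in> forms d \<Longrightarrow> q \<in> forms e \<Longrightarrow> p * q \<in> forms (d + e)"
  unfolding forms_def using keys_mult[of p q] by fastforce

lemma forms_single: "mon_deg m = d \<Longrightarrow> Poly_Mapping.single m c \<in> forms d"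
  by (auto simp: forms_iff lookup_single when_def)

lemma forms_PVar: "PVar v \<in> forms 1"
  by (simp add: PVar_def forms_single)

lemma forms_one: "1 \<in> forms 0"
  by (simp add: forms_def)

lemma forms_power: "p \<in> forms d \<Longrightarrow> p ^ n \<in> forms (n * d)"
  by (induction n) (auto simp: forms_one intro: forms_mult)

lemma lookup_hom_component:
  "Poly_Mapping.lookup (hom_component d p) m = (if mon_deg m = d then Poly_Mapping.lookup p m else 0)"
  by (auto simp: hom_component_def lookup_sum lookup_single when_def in_keys_iff)

lemma hom_component_forms: "hom_component d p \<in> forms d"
  by (simp add: forms_iff lookup_hom_component)

lemma hom_component_add: "hom_component d (p + q) = hom_component d p + hom_component d q"
  by (rule poly_mapping_eqI) (simp add: lookup_hom_component lookup_add)

lemma hom_component_zero: "hom_component d 0 = 0"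
  by (rule poly_mapping_eqI) (simp add: lookup_hom_component)

lemma hom_component_of_form:
  "p \<in> forms d \<Longrightarrow> hom_component e p = (if d = e then p else 0)"
  by (rule poly_mapping_eqI) (auto simp: lookup_hom_component forms_iff)

lemma hom_component_form_mult:
  assumes q: "q \<in> forms d"
  shows "hom_component t (q * p) = (if d \<le> t then q * hom_component (t - d) p else 0)"
proof (cases "d \<le> t")
  case True
  \<comment> \<open>The remainder \<open>p'\<close> has no component of degree \<open>t - d\<close>,
    so no monomial of \<open>q * p'\<close> has degree \<open>t\<close>.\<close>
  define p' where "p' = p - hom_component (t - d) p"
  have "mon_deg m \<noteq> t" if m: "m \<in> Poly_Mapping.keys (q * p')" for m
  proof -
    from m obtain a b where ab: "m = a + b" "a \<in> Poly_Mapping.keys q" "b \<in> Poly_Mapping.keys p'"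
      using keys_mult[of q p'] by auto
    then have "mon_deg b \<noteq> t - d"
      by (auto simp: p'_def in_keys_iff lookup_minus lookup_hom_component)
    moreover have "mon_deg a = d" using ab q by (auto simp: forms_def)
    ultimately show ?thesis using ab True by auto
  qed
  then have "hom_component t (q * p') = 0"
    by (intro poly_mapping_eqI) (auto simp: lookup_hom_component in_keys_iff)
  moreover have "q * hom_component (t - d) p \<in> forms t"
    using forms_mult[OF q hom_component_forms[of "t - d" p]] True by simp
  moreover have "q * p = q * p' + q * hom_component (t - d) p"
    by (simp add: p'_def algebra_simps)
  ultimately show ?thesis
    using True by (simp add: hom_component_add hom_component_of_form)
next
  case False
  have "mon_deg m \<noteq> t" if m: "m \<in> Poly_Mapping.keys (q * p)" for m
    using keys_mult[of q p] m q False by (force simp: forms_def)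
  then show ?thesis
    using False by (intro poly_mapping_eqI) (auto simp: lookup_hom_component in_keys_iff)
qed

lemma sum_hom_component: "p = (\<Sum>d\<in>mon_deg ` Poly_Mapping.keys p. hom_component d p)"
  by (rule poly_mapping_eqI)
     (force simp: lookup_sum lookup_hom_component in_keys_iff)

definition mon_eval :: "('v::finite \<Rightarrow> 'k::comm_ring_1) \<Rightarrow> ('v \<Rightarrow>\<^sub>0 nat) \<Rightarrow> 'k" where
  "mon_eval a m = (\<Prod>v\<in>UNIV. a v ^ Poly_Mapping.lookup m v)"

lemma mon_eval_add: "mon_eval a (m + n) = mon_eval a m * mon_eval a n"
  by (simp add: mon_eval_def lookup_add power_add prod.distrib)

lemma mon_eval_single: "mon_eval a (Poly_Mapping.single v n) = a v ^ n"
proof -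
  have "mon_eval a (Poly_Mapping.single v n) = (\<Prod>w\<in>UNIV. if w = v then a v ^ n else 1)"
    unfolding mon_eval_def by (rule prod.cong) (auto simp: lookup_single when_def)
  then show ?thesis by simp
qed

lemma mon_eval_zero [simp]: "mon_eval a 0 = 1"
  by (simp add: mon_eval_def)

lemma eval_at_eq_lin_ext: "eval_at p a = lin_ext (mon_eval a) p"
  by (simp add: eval_at_def lin_ext_def mon_eval_def)

lemma eval_at_zero [simp]: "eval_at 0 a = 0"
  and eval_at_one [simp]: "eval_at 1 a = 1"
  and eval_at_add: "eval_at (p + q) a = eval_at p a + eval_at q a"
  and eval_at_minus: "eval_at (p - q) a = eval_at p a - eval_at q a"
  and eval_at_sum: "eval_at (\<Sum>i\<in>A. f i) a = (\<Sum>i\<in>A. eval_at (f i) a)"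
  and eval_at_PConst [simp]: "eval_at (PConst c) a = c"
  and eval_at_PVar [simp]: "eval_at (PVar v) a = a v"
  by (simp_all add: eval_at_eq_lin_ext lin_ext_add lin_ext_minus lin_ext_sum PVar_def PConst_def mon_eval_single
      flip: single_one)

lemma eval_at_mult [simp]: "eval_at (p * q) a = eval_at p a * eval_at q a"
  unfolding eval_at_eq_lin_ext lin_ext_mult mon_eval_add
  unfolding lin_ext_def sum_product
  unfolding sum_distrib_left
  by (simp add: mult_ac)

lemma eval_at_power [simp]: "eval_at (p ^ n) a = eval_at p a ^ n"
  by (induction n) auto

lemma eval_at_prod: "eval_at (\<Prod>i\<in>A. f i) a = (\<Prod>i\<in>A. eval_at (f i) a)"
  by (induction A rule: infinite_finite_induct) auto

subsection \<open>The apolarity pairing\<close>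

text \<open>Subtraction of exponents is truncated, so monomials without the variable
  \<open>v\<close> are mapped to themselves in the defining sum. They carry the factor 0; on all
  others the shift is injective.\<close>

lemma lookup_pdiff:
  fixes g :: "('v::finite, 'k::comm_ring_1) mpoly"
  shows "Poly_Mapping.lookup (pdiff v g) m =
    of_nat (Suc (Poly_Mapping.lookup m v)) * Poly_Mapping.lookup g (Poly_Mapping.single v 1 + m)"
proof -
  let ?e = "Poly_Mapping.single v 1 :: 'v \<Rightarrow>\<^sub>0 nat"
  have split: "?e + (n - ?e) = n" if "Poly_Mapping.lookup n v > 0" for n
    using that by (intro poly_mapping_eqI) (auto simp: lookup_add lookup_minus lookup_single when_def)
  have "Poly_Mapping.lookup (pdiff v g) m = (\<Sum>n\<in>Poly_Mapping.keys g.
      of_nat (Poly_Mapping.lookup n v) * Poly_Mapping.lookup g n when n - ?e = m)"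
    by (simp add: pdiff_def lookup_sum lookup_single)
  also have "\<dots> = (\<Sum>n\<in>Poly_Mapping.keys g.
      if n = ?e + m then of_nat (Suc (Poly_Mapping.lookup m v)) * Poly_Mapping.lookup g n else 0)"
  proof (rule sum.cong[OF refl])
    fix n
    show "(of_nat (Poly_Mapping.lookup n v) * Poly_Mapping.lookup g n when n - ?e = m) =
      (if n = ?e + m then of_nat (Suc (Poly_Mapping.lookup m v)) * Poly_Mapping.lookup g n else 0)"
      using split[of n]
      by (cases "Poly_Mapping.lookup n v = 0") (auto simp: when_def lookup_add)
  qed
  also have "\<dots> = of_nat (Suc (Poly_Mapping.lookup m v)) * Poly_Mapping.lookup g (?e + m)"
    by (auto simp: in_keys_iff)
  finally show ?thesis .
qed

lemma pdiff_commute: "pdiff v (pdiff w g) = pdiff w (pdiff v g)"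
  by (rule poly_mapping_eqI, cases "v = w")
     (auto simp: lookup_pdiff lookup_add lookup_single when_def ac_simps)

lemma mon_diff_zero:
  fixes g :: "('v::finite, 'k::comm_ring_1) mpoly"
  shows "mon_diff 0 g = g"
proof -
  have "Finite_Set.fold (\<lambda>v. id) g A = g" if "finite A" for A :: "'v set"
    using that by induction (auto simp: comp_fun_commute_on.fold_insert[OF comp_fun_commute_on.intro, of UNIV])
  then show ?thesis by (simp add: mon_diff_def id_def[symmetric] funpow_0 del: funpow_0)
qed

text \<open>The operators commute, so the fold may apply the power of \<open>pdiff v\<close> last.
  The fold over the remaining variables is the same for both exponents.\<close>

lemma mon_diff_add_single:
  fixes g :: "('v::finite, 'k::comm_ring_1) mpoly"
  shows "mon_diff (Poly_Mapping.single v 1 + m) g = pdiff v (mon_diff m g)"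
proof -
  interpret c: comp_fun_commute "pdiff :: 'v \<Rightarrow> ('v, 'k) mpoly \<Rightarrow> _"
    by unfold_locales (auto simp: pdiff_commute)
  let ?f = "\<lambda>m v. (pdiff v :: ('v, 'k) mpoly \<Rightarrow> _) ^^ Poly_Mapping.lookup m v"
  have fold_UNIV: "mon_diff n g = ?f n v (Finite_Set.fold (?f n) g (UNIV - {v}))" for n
  proof -
    interpret d: comp_fun_commute "?f n" by (rule c.comp_fun_commute_funpow)
    show ?thesis unfolding mon_diff_def by (rule d.fold_rec) auto
  qed
  have "Finite_Set.fold (?f (Poly_Mapping.single v 1 + m)) g (UNIV - {v}) =
      Finite_Set.fold (?f m) g (UNIV - {v})"
  proof (rule Finite_Set.fold_cong[OF c.comp_fun_commute_on_funpow c.comp_fun_commute_on_funpow])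
  qed (auto simp: lookup_add lookup_single when_def)
  then show ?thesis
    by (simp add: fold_UNIV lookup_add)
qed

text \<open>The multi-index factorial \<open>m!\<close> in the field. Coefficients multiplied by it
  are the coordinates in the divided power basis, in which differentiation only shifts exponents;
  see \<open>lookup_mon_diff\<close>.\<close>

definition mon_fact :: "('v::finite \<Rightarrow>\<^sub>0 nat) \<Rightarrow> 'k::comm_ring_1" where
  "mon_fact m = (\<Prod>v\<in>UNIV. of_nat (fact (Poly_Mapping.lookup m v)))"

lemma mon_fact_nonzero [simp]: "mon_fact m \<noteq> (0 :: 'k::field_char_0)"
  by (simp add: mon_fact_def)

lemma mon_fact_add_single:
  "mon_fact (Poly_Mapping.single v 1 + m) = of_nat (Suc (Poly_Mapping.lookup m v)) * mon_fact m"
proof -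
  have "mon_fact (Poly_Mapping.single v 1 + m) =
    (\<Prod>w\<in>UNIV. (if w = v then of_nat (Suc (Poly_Mapping.lookup m v)) else 1) *
       of_nat (fact (Poly_Mapping.lookup m w)))"
    unfolding mon_fact_def by (rule prod.cong) (auto simp: lookup_add lookup_single when_def distrib_right)
  then show ?thesis by (simp add: prod.distrib mon_fact_def)
qed

lemma monomial_induct [case_names zero add]:
  assumes "Q 0" and "\<And>v m. Q m \<Longrightarrow> Q (Poly_Mapping.single v 1 + m)"
  shows "Q (m :: 'v::finite \<Rightarrow>\<^sub>0 nat)"
proof (induction "mon_deg m" arbitrary: m)
  case 0
  then have "m = 0" by (auto simp: mon_deg_def intro: poly_mapping_eqI)
  then show ?case using assms(1) by simp
next
  case (Suc d)
  then have "mon_deg m \<noteq> 0" by simp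
  then obtain v where v: "Poly_Mapping.lookup m v > 0"
    by (auto simp: mon_deg_def)
  then have m: "m = Poly_Mapping.single v 1 + (m - Poly_Mapping.single v 1)"
    by (intro poly_mapping_eqI) (auto simp: lookup_add lookup_minus lookup_single when_def)
  then have "mon_deg m = Suc (mon_deg (m - Poly_Mapping.single v 1))"
    by (metis mon_deg_add mon_deg_single plus_1_eq_Suc)
  then show ?case using Suc assms(2) m by (metis nat.inject)
qed

lemma lookup_mon_diff:
  "mon_fact m * Poly_Mapping.lookup (mon_diff k g) m = mon_fact (m + k) * Poly_Mapping.lookup g (m + k)"
proof (induction k arbitrary: m rule: monomial_induct)
  case zero
  then show ?case by (simp add: mon_diff_zero)
next
  case (add v k)
  have "mon_fact m * Poly_Mapping.lookup (mon_diff (Poly_Mapping.single v 1 + k) g) m =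
      mon_fact (Poly_Mapping.single v 1 + m) *
      Poly_Mapping.lookup (mon_diff k g) (Poly_Mapping.single v 1 + m)"
    unfolding mon_diff_add_single lookup_pdiff mon_fact_add_single by (simp add: mult_ac)
  also have "\<dots> = mon_fact (Poly_Mapping.single v 1 + m + k) *
      Poly_Mapping.lookup g (Poly_Mapping.single v 1 + m + k)"
    by (rule add.IH)
  finally show ?case by (simp add: ac_simps)
qed

text \<open>This is the constant term of \<open>diff_act f g\<close>.\<close>

definition apolar :: "('v::finite, 'k::comm_ring_1) mpoly \<Rightarrow> ('v, 'k) mpoly \<Rightarrow> 'k" where
  "apolar f g = lin_ext (\<lambda>m. mon_fact m * Poly_Mapping.lookup g m) f"

lemma apolar_single: "apolar (Poly_Mapping.single m c) g = c * (mon_fact m * Poly_Mapping.lookup g m)"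
  by (simp add: apolar_def)

text \<open>The pairing is nondegenerate: a monomial picks out one coefficient times
  \<open>m!\<close>, which is invertible in characteristic zero.\<close>

lemma apolar_eqI:
  fixes g g' :: "('v::finite, 'k::field_char_0) mpoly"
  assumes "\<And>m. apolar (Poly_Mapping.single m 1) g = apolar (Poly_Mapping.single m 1) g'"
  shows "g = g'"
  using assms by (intro poly_mapping_eqI) (simp add: apolar_single)

text \<open>By \<open>lookup_mon_diff\<close>, \<open>m!\<close> times the coefficient of
  \<open>diff_act f g\<close> at \<open>m\<close> is a functional of \<open>f\<close> with weights
  at \<open>m + k\<close>; \<open>lin_ext_mult\<close> collects these into the product
  \<open>h * f\<close>.\<close>

lemma apolar_diff_act: "apolar h (diff_act f g) = apolar (h * f) g"
proof -
  have "mon_fact m * Poly_Mapping.lookup (diff_act f g) m =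
      lin_ext (\<lambda>k. mon_fact (m + k) * Poly_Mapping.lookup g (m + k)) f" for m
    by (simp add: diff_act_def lookup_sum lin_ext_def sum_distrib_left lookup_mon_diff
        mult.left_commute[of "mon_fact m"])
  then show ?thesis
    by (simp add: apolar_def lin_ext_mult)
qed

lemma apolar_zero_right [simp]: "apolar f 0 = 0"
  by (simp add: apolar_def lin_ext_def)

lemma self_in_gen_submodule:
  fixes F :: "('v::finite, 'k::field_char_0) mpoly"
  shows "F \<in> gen_submodule F"
proof -
  have "F = diff_act 1 F"
    by (rule apolar_eqI) (simp add: apolar_diff_act)
  then show ?thesis unfolding gen_submodule_def by blast
qed

text \<open>Adjunction together with nondegeneracy; annihilation is from here on tested by scalars
  only.\<close>

lemma diff_act_eq_0_iff:
  fixes g :: "('v::finite, 'k::field_char_0) mpoly"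
  shows "diff_act f g = 0 \<longleftrightarrow> (\<forall>h. apolar (h * f) g = 0)"
proof
  assume "diff_act f g = 0"
  then show "\<forall>h. apolar (h * f) g = 0"
    by (simp flip: apolar_diff_act)
next
  assume "\<forall>h. apolar (h * f) g = 0"
  then show "diff_act f g = 0"
    by (intro apolar_eqI) (simp add: apolar_diff_act apolar_single)
qed

lemma apolar_minus_left: "apolar (f - f') g = apolar f g - apolar f' g"
  and apolar_sum_left: "apolar (\<Sum>i\<in>A. p i) g = (\<Sum>i\<in>A. apolar (p i) g)"
  and apolar_PConst_left: "apolar (PConst c * f) g = c * apolar f g"
  by (simp_all add: apolar_def lin_ext_add lin_ext_minus lin_ext_sum)

lemma apolar_sum_PConst_right: "apolar f (\<Sum>i\<in>A. PConst (c i) * p i) = (\<Sum>i\<in>A. c i * apolar f (p i))"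
  unfolding apolar_def lin_ext_def lookup_sum lookup_PConst_mult sum_distrib_left
  by (subst sum.swap) (simp add: mult_ac)

text \<open>Different monomials are orthogonal, so components of \<open>f\<close> in other degrees
  contribute nothing.\<close>

lemma apolar_hom_component:
  assumes "g \<in> forms s"
  shows "apolar (hom_component s f) g = apolar f g"
proof -
  have "Poly_Mapping.keys (hom_component s f) \<subseteq> Poly_Mapping.keys f"
    by (auto simp: in_keys_iff lookup_hom_component split: if_splits)
  then have "apolar (hom_component s f) g = (\<Sum>m\<in>Poly_Mapping.keys f.
      Poly_Mapping.lookup (hom_component s f) m * (mon_fact m * Poly_Mapping.lookup g m))"
    unfolding apolar_def by (intro lin_ext_superset) auto
  also have "\<dots> = apolar f g"
    unfolding apolar_def lin_ext_def
    by (rule sum.cong) (use assms in \<open>auto simp: lookup_hom_component forms_iff, metis mult_zero_right\<close>)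
  finally show ?thesis .
qed

text \<open>If \<open>v\<close> does not occur in \<open>m\<close>, both sides are 0 despite the
  truncated subtraction. The sum over all variables in the next induction thus needs no side
  condition.\<close>

lemma lookup_PVar_mult:
  fixes p :: "('v::finite, 'k::comm_ring_1) mpoly"
  shows "of_nat (Poly_Mapping.lookup m v) * mon_fact (m - Poly_Mapping.single v 1) * Poly_Mapping.lookup p (m - Poly_Mapping.single v 1) =
     mon_fact m * Poly_Mapping.lookup (PVar v * p) m"
proof (cases "Poly_Mapping.lookup m v = 0")
  case True
  have "m \<notin> Poly_Mapping.keys (PVar v * p)"
    using keys_mult[of "PVar v" p] True by (auto simp: PVar_def lookup_add)
  then show ?thesis using True by (simp add: in_keys_iff)
next
  case False
  define n where "n = m - Poly_Mapping.single v 1"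
  have m: "m = Poly_Mapping.single v 1 + n"
    using False unfolding n_def
    by (intro poly_mapping_eqI) (auto simp: lookup_add lookup_minus lookup_single when_def)
  have "Poly_Mapping.lookup (PVar v * p) m = Poly_Mapping.lookup p n"
    unfolding m PVar_def lookup_single_mult by simp
  moreover have "mon_fact m = of_nat (Poly_Mapping.lookup m v) * (mon_fact n :: 'k)"
    unfolding m mon_fact_add_single by (simp add: lookup_add)
  ultimately show ?thesis by (simp add: n_def)
qed

text \<open>The multinomial theorem, with denominators cleared. In the induction one factor is
  expanded as the sum of the \<open>a v * PVar v\<close>; the exponents of \<open>m\<close> add up
  to \<open>Suc s\<close>, which turns \<open>fact s\<close> into
  \<open>fact (Suc s)\<close>.\<close>

lemma lookup_lin_form_power:
  fixes a :: "'v::finite \<Rightarrow> 'k::field_char_0"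
  shows "mon_fact m * Poly_Mapping.lookup (lin_form a ^ s) m = (if mon_deg m = s then fact s * mon_eval a m else 0)"
proof (induction s arbitrary: m)
  case 0
  have "mon_deg m = 0 \<longleftrightarrow> m = 0"
    by (auto simp: mon_deg_def intro: poly_mapping_eqI)
  then show ?case by (auto simp: lookup_one when_def mon_fact_def)
next
  case (Suc s)
  let ?e = "\<lambda>v. Poly_Mapping.single v (1::nat)"
  have step: "a v * (of_nat (Poly_Mapping.lookup m v) * mon_fact (m - ?e v) * Poly_Mapping.lookup (lin_form a ^ s) (m - ?e v))
      = of_nat (Poly_Mapping.lookup m v) * (if mon_deg m = Suc s then fact s * mon_eval a m else 0)" for v
  proof (cases "Poly_Mapping.lookup m v = 0")
    case False
    define n where "n = m - ?e v"
    have m: "m = ?e v + n"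
      using False unfolding n_def
      by (intro poly_mapping_eqI) (auto simp: lookup_add lookup_minus lookup_single when_def)
    have "mon_deg m = Suc (mon_deg n)" "mon_eval a m = a v * mon_eval a n"
      unfolding m by (simp_all add: mon_eval_add mon_eval_single)
    then show ?thesis
      unfolding n_def[symmetric] by (simp add: Suc.IH mult.assoc)
  qed simp
  have "Poly_Mapping.lookup (lin_form a ^ Suc s) m =
      (\<Sum>v\<in>UNIV. a v * Poly_Mapping.lookup (PVar v * lin_form a ^ s) m)"
    by (subst power_Suc, subst (1) lin_form_def)
       (simp add: sum_distrib_right lookup_sum mult.assoc)
  then have "mon_fact m * Poly_Mapping.lookup (lin_form a ^ Suc s) m =
      (\<Sum>v\<in>UNIV. a v * (mon_fact m * Poly_Mapping.lookup (PVar v * lin_form a ^ s) m))"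
    by (simp add: sum_distrib_left mult.left_commute[of "mon_fact m"])
  also have "\<dots> = (\<Sum>v\<in>UNIV. of_nat (Poly_Mapping.lookup m v) *
      (if mon_deg m = Suc s then fact s * mon_eval a m else 0))"
    unfolding lookup_PVar_mult[symmetric] step ..
  also have "\<dots> = of_nat (mon_deg m) * (if mon_deg m = Suc s then fact s * mon_eval a m else 0)"
    by (simp add: mon_deg_def sum_distrib_right)
  finally show ?case by simp
qed

lemma apolar_lin_form_power:
  fixes a :: "'v::finite \<Rightarrow> 'k::field_char_0"
  shows "apolar f (lin_form a ^ s) = fact s * eval_at (hom_component s f) a"
proof -
  have "apolar f (lin_form a ^ s) = (\<Sum>m\<in>Poly_Mapping.keys f. fact s * (Poly_Mapping.lookup (hom_component s f) m * mon_eval a m))"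
    unfolding apolar_def lin_ext_def lookup_lin_form_power
    by (rule sum.cong) (auto simp: lookup_hom_component)
  also have "\<dots> = fact s * lin_ext (mon_eval a) (hom_component s f)"
    unfolding sum_distrib_left[symmetric]
    by (subst lin_ext_superset[of "Poly_Mapping.keys f"]) (auto simp: in_keys_iff lookup_hom_component split: if_splits)
  finally show ?thesis by (simp add: eval_at_eq_lin_ext)
qed

subsection \<open>Ideals\<close>

text \<open>Translates the ring record into the operations of the type. Closure under negation is
  multiplication by -1.\<close>

lemma ideal_polyring_iff:
  "ideal I (polyring :: ('v, 'k::comm_ring_1) mpoly ring) \<longleftrightarrow>
     0 \<in> I \<and> (\<forall>a\<in>I. \<forall>b\<in>I. a + b \<in> I) \<and> (\<forall>a\<in>I. \<forall>x. x * a \<in> I)"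
proof
  assume "ideal I (polyring :: ('v, 'k) mpoly ring)"
  then interpret ideal I "polyring :: ('v, 'k) mpoly ring" .
  show "0 \<in> I \<and> (\<forall>a\<in>I. \<forall>b\<in>I. a + b \<in> I) \<and> (\<forall>a\<in>I. \<forall>x. x * a \<in> I)"
    using additive_subgroup.zero_closed[OF additive_subgroup_axioms]
      additive_subgroup.a_closed[OF additive_subgroup_axioms] I_l_closed
    by (simp add: ring_of_type_algebra_def)
next
  assume I: "0 \<in> I \<and> (\<forall>a\<in>I. \<forall>b\<in>I. a + b \<in> I) \<and> (\<forall>a\<in>I. \<forall>x. x * a \<in> I)"
  interpret R: cring "polyring :: ('v, 'k) mpoly ring"
    by (rule cring_from_type_algebra)
  have "\<ominus>\<^bsub>polyring\<^esub> a = - a" for a :: "('v, 'k) mpoly"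
    by (rule R.minus_equality) (auto simp: ring_of_type_algebra_def)
  then have uminus: "inv\<^bsub>\<lparr>carrier = UNIV, monoid.mult = (+), one = 0\<rparr>\<^esub> a = - a" for a :: "('v, 'k) mpoly"
    by (simp add: a_inv_def ring_of_type_algebra_def)
  have "- a \<in> I" if "a \<in> I" for a
    using I that by (metis mult_minus1)
  with I show "ideal I (polyring :: ('v, 'k) mpoly ring)"
    by (intro idealI R.ring_axioms)
       (auto intro!: subgroup.intro simp: ring_of_type_algebra_def mult.commute uminus)
qed

lemma ideal_sum:
  assumes "ideal I (polyring :: ('v, 'k::comm_ring_1) mpoly ring)" "\<And>i. i \<in> A \<Longrightarrow> f i \<in> I"
  shows "(\<Sum>i\<in>A. f i) \<in> I"
  using assms by (induction A rule: infinite_finite_induct) (auto simp: ideal_polyring_iff)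

lemma ideal_minus:
  assumes "ideal I (polyring :: ('v, 'k::comm_ring_1) mpoly ring)" "a \<in> I" "b \<in> I"
  shows "a - b \<in> I"
  using assms unfolding ideal_polyring_iff by (metis mult_minus1 uminus_add_conv_diff add.commute)

text \<open>The right-hand side describes an ideal, because a component of a product is a sum of
  products of components. It contains the generating forms; conversely, all components of such an
  \<open>f\<close> are generators.\<close>

lemma vanishing_ideal_iff:
  fixes Z :: "('v::finite \<Rightarrow> 'k::field) set"
  shows "f \<in> vanishing_ideal Z \<longleftrightarrow> (\<forall>a\<in>Z. \<forall>d. eval_at (hom_component d f) a = 0)"
proof -
  interpret R: cring "polyring :: ('v, 'k) mpoly ring"
    by (rule cring_from_type_algebra)
  let ?G = "{f :: ('v, 'k) mpoly. (\<exists>d. f \<in> forms d) \<and> (\<forall>a\<in>Z. eval_at f a = 0)}"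
  let ?I = "{f :: ('v, 'k) mpoly. \<forall>a\<in>Z. \<forall>d. eval_at (hom_component d f) a = 0}"
  have carr: "?G \<subseteq> carrier polyring" by (simp add: ring_of_type_algebra_def)
  have id: "ideal (vanishing_ideal Z) polyring"
    unfolding vanishing_ideal_def by (rule R.genideal_ideal[OF carr])
  have G: "?G \<subseteq> vanishing_ideal Z"
    unfolding vanishing_ideal_def by (rule R.genideal_self[OF carr])
  have mult: "eval_at (hom_component d (x * p)) a = 0" if "p \<in> ?I" "a \<in> Z" for x p a d
  proof -
    have "hom_component d (x * p) = (\<Sum>e\<in>mon_deg ` Poly_Mapping.keys x. hom_component d (hom_component e x * p))"
    proof -
      have sum: "hom_component d (\<Sum>i\<in>A. u i) = (\<Sum>i\<in>A. hom_component d (u i))"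
        for A :: "nat set" and u :: "nat \<Rightarrow> ('v, 'k) mpoly"
        by (rule poly_mapping_eqI) (simp add: lookup_hom_component lookup_sum)
      have "x * p = (\<Sum>e\<in>mon_deg ` Poly_Mapping.keys x. hom_component e x * p)"
        by (subst sum_hom_component[of x]) (rule sum_distrib_right)
      then show ?thesis by (simp only: sum)
    qed
    then show ?thesis
      using that
      by (auto simp: eval_at_sum hom_component_form_mult[OF hom_component_forms] intro!: sum.neutral)
  qed
  have "ideal ?I polyring"
    unfolding ideal_polyring_iff
  proof (intro conjI ballI allI)
    show "(0::('v, 'k) mpoly) \<in> ?I"
      by (simp add: hom_component_zero)
  qed (use mult in \<open>auto simp: hom_component_add eval_at_add\<close>)
  moreover have "?G \<subseteq> ?I"
    by (auto simp: hom_component_of_form)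
  ultimately have "vanishing_ideal Z \<subseteq> ?I"
    unfolding vanishing_ideal_def by (rule R.genideal_minimal)
  moreover have "?I \<subseteq> vanishing_ideal Z"
  proof
    fix f assume f: "f \<in> ?I"
    then have "hom_component d f \<in> vanishing_ideal Z" for d
      using hom_component_forms[of d f] by (intro subsetD[OF G]) auto
    then show "f \<in> vanishing_ideal Z"
      by (subst sum_hom_component) (rule ideal_sum[OF id])
  qed
  ultimately show ?thesis by auto
qed

lemma ideal_vanishing_ideal: "ideal (vanishing_ideal Z) (polyring :: ('v::finite, 'k::field) mpoly ring)"
  unfolding vanishing_ideal_def
  by (rule ring.genideal_ideal[OF ring_from_type_algebra]) (simp add: ring_of_type_algebra_def)

lemma form_in_vanishing_ideal_iff:
  "f \<in> forms d \<Longrightarrow> f \<in> vanishing_ideal Z \<longleftrightarrow> (\<forall>a\<in>Z. eval_at f a = 0)"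
  by (auto simp: vanishing_ideal_iff hom_component_of_form)

lemma set_add_PIdl_iff:
  fixes I :: "('v, 'k::comm_ring_1) mpoly set"
  shows "f \<in> I <+>\<^bsub>polyring\<^esub> PIdl\<^bsub>polyring\<^esub> p \<longleftrightarrow> (\<exists>g h. g \<in> I \<and> f = g + p * h)"
  by (auto simp: set_add_def' cgenideal_def ring_of_type_algebra_def mult.commute)

lemma ideal_set_add_PIdl:
  assumes "ideal I (polyring :: ('v, 'k::comm_ring_1) mpoly ring)"
  shows "ideal (I <+>\<^bsub>polyring\<^esub> PIdl\<^bsub>polyring\<^esub> p) polyring"
proof -
  interpret R: cring "polyring :: ('v, 'k) mpoly ring"
    by (rule cring_from_type_algebra)
  show ?thesis
    by (intro R.add_ideals assms R.cgenideal_ideal) (simp add: ring_of_type_algebra_def)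
qed

text \<open>Choose a functional \<open>\<phi>\<close> on \<open>R\<close> that vanishes on \<open>J\<close> but not at \<open>f\<close>. As \<open>J\<close> contains all forms of
  degree larger than \<open>s\<close>, \<open>\<phi>\<close> is the pairing with a polynomial, which then lies in \<open>perp J\<close>.\<close>

lemma ideal_eq_annihilator:
  fixes J :: "('v::finite, 'k::field_char_0) mpoly set"
  assumes J: "ideal J polyring" and s: "\<And>t. t > s \<Longrightarrow> forms t \<subseteq> J"
    and F: "perp J = gen_submodule F"
  shows "f \<in> J \<longleftrightarrow> (\<forall>h. apolar (h * f) F = 0)"
proof
  assume f: "f \<in> J"
  have "F \<in> perp J"
    unfolding F by (rule self_in_gen_submodule)
  then show "\<forall>h. apolar (h * f) F = 0"
    using f by (simp add: perp_def diff_act_eq_0_iff)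
next
  assume ann: "\<forall>h. apolar (h * f) F = 0"
  interpret vp: vector_space_pair "\<lambda>c (p :: ('v, 'k) mpoly). PConst c * p" "(*) :: 'k \<Rightarrow> 'k \<Rightarrow> 'k"
    by unfold_locales (auto simp: algebra_simps)
  show "f \<in> J"
  proof (rule ccontr)
    assume "f \<notin> J"
    have sub: "mpoly.subspace J"
      using J by (auto simp: mpoly.subspace_def ideal_polyring_iff)
    obtain B where B: "B \<subseteq> J" "mpoly.independent B" "J \<subseteq> mpoly.span B"
      and "card B = mpoly.dim J"
      by (rule mpoly.basis_exists)
    have "f \<notin> mpoly.span B"
      using B(1) sub \<open>f \<notin> J\<close> mpoly.span_minimal by blast
    then have "mpoly.independent (insert f B)"
      using B(2) by (rule mpoly.independent_insertI)
    then obtain \<phi> where lin: "Vector_Spaces.linear (\<lambda>c p. PConst c * p) (*) \<phi>"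
      and \<phi>: "\<And>x. x \<in> insert f B \<Longrightarrow> \<phi> x = (if x = f then 1 else 0)"
      using vp.linear_independent_extend[of "insert f B" "\<lambda>x. if x = f then 1 else 0"] by blast
    interpret \<phi>: Vector_Spaces.linear "\<lambda>c (p :: ('v, 'k) mpoly). PConst c * p" "(*)" \<phi> by (rule lin)
    have \<phi>J: "\<phi> g = 0" if "g \<in> J" for g
    proof (rule \<phi>.eq_0_on_span)
      show "g \<in> mpoly.span B" using B that by auto
      show "\<phi> b = 0" if "b \<in> B" for b using \<phi>[of b] that B \<open>f \<notin> J\<close> by auto
    qed
    \<comment> \<open>Division by \<open>m!\<close> compensates the factor in the pairing. Cutting
      off at degree \<open>s\<close> loses nothing, since \<open>\<phi>\<close> is 0 on the higher
      monomials, which lie in \<open>J\<close>.\<close>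
    define G where "G = (\<Sum>m | mon_deg m \<le> s.
      Poly_Mapping.single m (\<phi> (Poly_Mapping.single m 1) / mon_fact m))"
    have G: "mon_fact m * Poly_Mapping.lookup G m = \<phi> (Poly_Mapping.single m 1)" for m
    proof (cases "mon_deg m \<le> s")
      case True
      then show ?thesis
        by (simp add: G_def lookup_sum lookup_single when_def finite_mon_deg_le)
    next
      case False
      then have "Poly_Mapping.single m 1 \<in> J"
        using s[of "mon_deg m"] forms_single[OF refl, of m 1] by auto
      then show ?thesis
        using False \<phi>J by (simp add: G_def lookup_sum lookup_single when_def finite_mon_deg_le)
    qed
    have pair: "apolar g G = \<phi> g" for g
    proof -
      have "\<phi> g = \<phi> (\<Sum>m\<in>Poly_Mapping.keys g. PConst (Poly_Mapping.lookup g m) * Poly_Mapping.single m 1)"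
        using poly_mapping_eq_sum_single[of g] by simp
      also have "\<dots> = apolar g G"
        unfolding \<phi>.sum \<phi>.scale apolar_def lin_ext_def G ..
      finally show ?thesis by simp
    qed
    have "G \<in> perp J"
      using J \<phi>J by (auto simp: perp_def diff_act_eq_0_iff pair ideal_polyring_iff)
    \<comment> \<open>Now \<open>apolar f G = apolar (f * h) F = 0\<close>, whereas
      \<open>\<phi> f = 1\<close>.\<close>
    then obtain h where "G = diff_act h F"
      by (auto simp: F gen_submodule_def)
    then have "apolar f G = 0"
      using ann by (metis apolar_diff_act mult.commute)
    moreover have "apolar f G = 1" using pair \<phi>[of f] by simp
    ultimately show False by simp
  qed
qed

subsection \<open>Independence modulo a subspace\<close>

text \<open>Gaussian elimination, by induction on the equations \<open>T\<close>. If the new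
  equation \<open>t\<close> involves an unknown \<open>b0\<close>, then \<open>b0\<close> is
  eliminated from the others and its value is recovered from \<open>t\<close>.\<close>

lemma exists_nontrivial_solution:
  fixes M :: "'b \<Rightarrow> 'c \<Rightarrow> 'k::field"
  assumes "finite T" "finite S" "card T < card S"
  shows "\<exists>c. (\<exists>b\<in>S. c b \<noteq> 0) \<and> (\<forall>t\<in>T. (\<Sum>b\<in>S. c b * M b t) = 0)"
  using assms
proof (induction T arbitrary: S M rule: finite_induct)
  case empty
  then have "S \<noteq> {}" by auto
  then show ?case by (intro exI[of _ "\<lambda>_. 1"]) auto
next
  case (insert t T)
  show ?case
  proof (cases "\<forall>b\<in>S. M b t = 0")
    case True
    obtain c where "\<exists>b\<in>S. c b \<noteq> 0" "\<forall>t\<in>T. (\<Sum>b\<in>S. c b * M b t) = 0"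
      using insert.IH[of S M] insert.prems insert.hyps by auto
    with True show ?thesis by (intro exI[of _ c]) auto
  next
    case False
    then obtain b0 where b0: "b0 \<in> S" "M b0 t \<noteq> 0" by auto
    let ?S = "S - {b0}"
    have card: "card T < card ?S" "finite ?S"
      using insert.prems insert.hyps b0 by auto
    obtain c where c: "\<exists>b\<in>?S. c b \<noteq> 0"
        "\<forall>u\<in>T. (\<Sum>b\<in>?S. c b * (M b u - M b t / M b0 t * M b0 u)) = 0"
      using insert.IH[of ?S "\<lambda>b u. M b u - M b t / M b0 t * M b0 u"] card insert.prems(1)
      by blast
    define c' where "c' = c(b0 := - (\<Sum>b\<in>?S. c b * M b t) / M b0 t)"
    have split: "(\<Sum>b\<in>S. c' b * M b u) = c' b0 * M b0 u + (\<Sum>b\<in>?S. c b * M b u)" for u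
      by (subst sum.remove[OF insert.prems(1) b0(1)]) (auto simp: c'_def intro!: sum.cong)
    have "(\<Sum>b\<in>S. c' b * M b u) = 0" if "u \<in> insert t T" for u
    proof (cases "u = t")
      case True
      then show ?thesis unfolding split using b0 by (simp add: c'_def)
    next
      case False
      then have "(\<Sum>b\<in>?S. c b * M b u) = (\<Sum>b\<in>?S. c b * M b t / M b0 t * M b0 u)"
        using c(2) that by (auto simp: right_diff_distrib sum_subtractf mult.assoc)
      also have "\<dots> = - c' b0 * M b0 u"
        by (simp add: c'_def sum_distrib_right sum_divide_distrib)
      finally show ?thesis unfolding split by simp
    qed
    moreover have "\<exists>b\<in>S. c' b \<noteq> 0"
      using c(1) by (auto simp: c'_def)
    ultimately show ?thesis by blast
  qed
qed

text \<open>The independence clause of \<open>has_quot_dim\<close>, separated from the spanning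
  clause so that one set can be studied modulo two ideals.\<close>

definition indep_mod :: "('v, 'k::field) mpoly set \<Rightarrow> ('v, 'k) mpoly set \<Rightarrow> bool" where
  "indep_mod W S \<longleftrightarrow> (\<forall>c. (\<Sum>b\<in>S. PConst (c b) * b) \<in> W \<longrightarrow> (\<forall>b\<in>S. c b = 0))"

lemma PConst_add: "PConst (c + d) = PConst c + PConst d"
  by (simp add: PConst_def single_add)

lemma PConst_zero [simp]: "PConst 0 = 0"
  by (simp add: PConst_def)

lemma PConst_sum:
  fixes c :: "'a \<Rightarrow> 'k::comm_ring_1"
  shows "(PConst (sum c A) :: ('v,'k) mpoly) = sum (\<lambda>i. PConst (c i)) A"
  using sum_comp_morphism[of "PConst :: 'k \<Rightarrow> ('v,'k) mpoly" c A, OF PConst_zero PConst_add] by (simp only: o_def)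

lemma PConst_mult: "PConst (c * d) = PConst c * PConst d"
  by (simp add: PConst_def mult_single)

lemma linear_combination_of_linear_combinations:
  fixes B :: "('v, 'k::field) mpoly set"
  shows "(\<Sum>a\<in>A. PConst (c a) * (\<Sum>b\<in>B. PConst (M a b) * b)) =
    (\<Sum>b\<in>B. PConst (\<Sum>a\<in>A. c a * M a b) * b)"
proof -
  have "(\<Sum>a\<in>A. PConst (c a) * (\<Sum>b\<in>B. PConst (M a b) * b)) =
      (\<Sum>a\<in>A. \<Sum>b\<in>B. PConst (c a * M a b) * b)"
    by (simp only: sum_distrib_left PConst_mult mult.assoc)
  also have "\<dots> = (\<Sum>b\<in>B. \<Sum>a\<in>A. PConst (c a * M a b) * b)"
    by (rule sum.swap)
  also have "\<dots> = (\<Sum>b\<in>B. PConst (\<Sum>a\<in>A. c a * M a b) * b)"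
    by (rule sum.cong[OF refl]) (simp only: PConst_sum sum_distrib_right)
  finally show ?thesis .
qed

text \<open>With more elements in \<open>S\<close> than in \<open>T\<close>, the coordinate vectors
  modulo \<open>W\<close> satisfy a nontrivial linear relation, which lifts to a relation in
  \<open>S\<close>.\<close>

lemma indep_mod_card_le:
  fixes W :: "('v, 'k::field) mpoly set"
  assumes W: "ideal W polyring" and fin: "finite S" "finite T" and S: "indep_mod W S"
    and T: "\<And>b. b \<in> S \<Longrightarrow> \<exists>c. b - (\<Sum>t\<in>T. PConst (c t) * t) \<in> W"
  shows "card S \<le> card T"
proof (rule ccontr)
  assume "\<not> card S \<le> card T"
  obtain M where M: "\<forall>b\<in>S. b - (\<Sum>t\<in>T. PConst (M b t) * t) \<in> W"
    using bchoice[of S "\<lambda>b c. b - (\<Sum>t\<in>T. PConst (c t) * t) \<in> W"] T by blast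
  obtain c where c: "\<exists>b\<in>S. c b \<noteq> 0" "\<forall>t\<in>T. (\<Sum>b\<in>S. c b * M b t) = 0"
    using exists_nontrivial_solution[OF fin(2,1), of M] \<open>\<not> card S \<le> card T\<close> by auto
  have "(\<Sum>b\<in>S. PConst (c b) * (\<Sum>t\<in>T. PConst (M b t) * t)) = (\<Sum>t\<in>T. PConst (\<Sum>b\<in>S. c b * M b t) * t)"
    by (rule linear_combination_of_linear_combinations)
  also have "\<dots> = 0" using c(2) by (simp add: PConst_def)
  finally have "(\<Sum>b\<in>S. PConst (c b) * b) = (\<Sum>b\<in>S. PConst (c b) * (b - (\<Sum>t\<in>T. PConst (M b t) * t)))"
    by (simp add: right_diff_distrib sum_subtractf)
  also have "\<dots> \<in> W"
    using W M by (intro ideal_sum) (auto simp: ideal_polyring_iff)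
  finally show False using S c(1) by (auto simp: indep_mod_def)
qed

text \<open>A relation with nonzero coefficient at \<open>f\<close> could be divided by it and would
  express \<open>f\<close> by \<open>S\<close> modulo \<open>W\<close>.\<close>

lemma indep_mod_insert:
  fixes W :: "('v, 'k::field) mpoly set"
  assumes W: "ideal W polyring" and fin: "finite S" and S: "indep_mod W S"
    and f: "\<And>c. f - (\<Sum>b\<in>S. PConst (c b) * b) \<notin> W"
  shows "f \<notin> S" "indep_mod W (insert f S)"
proof -
  show "f \<notin> S"
  proof
    assume "f \<in> S"
    then have "(\<Sum>b\<in>S. PConst (if b = f then 1 else 0) * b) = (\<Sum>b\<in>S. if b = f then b else 0)"
      by (intro sum.cong) (auto simp: PConst_def)
    also have "\<dots> = f" using fin \<open>f \<in> S\<close> by simp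
    finally show False using f[of "\<lambda>b. if b = f then 1 else 0"] W by (simp add: ideal_polyring_iff)
  qed
  show "indep_mod W (insert f S)"
    unfolding indep_mod_def
  proof (intro allI impI)
    fix c assume "(\<Sum>b\<in>insert f S. PConst (c b) * b) \<in> W"
    then have c: "PConst (c f) * f + (\<Sum>b\<in>S. PConst (c b) * b) \<in> W"
      using fin \<open>f \<notin> S\<close> by simp
    have "c f = 0"
    proof (rule ccontr)
      assume "c f \<noteq> 0"
      then have inv: "PConst (inverse (c f)) * PConst (c f) = 1"
        unfolding PConst_mult[symmetric] by (simp add: PConst_def)
      have "PConst (inverse (c f)) * (PConst (c f) * f + (\<Sum>b\<in>S. PConst (c b) * b)) \<in> W"
        using W c by (auto simp: ideal_polyring_iff)
      also have "PConst (inverse (c f)) * (PConst (c f) * f + (\<Sum>b\<in>S. PConst (c b) * b)) =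
          f + (\<Sum>b\<in>S. PConst (inverse (c f) * c b) * b)"
        by (simp add: distrib_left mult.assoc[symmetric] inv sum_distrib_left PConst_mult)
      also have "\<dots> = f - (\<Sum>b\<in>S. PConst (- (inverse (c f) * c b)) * b)"
        by (simp add: PConst_def single_uminus sum_negf)
      finally show False using f[of "\<lambda>b. - (inverse (c f) * c b)"] by simp
    qed
    moreover from this have "\<forall>b\<in>S. c b = 0"
      using c S by (simp add: indep_mod_def PConst_def)
    ultimately show "\<forall>b\<in>insert f S. c b = 0" by simp
  qed
qed

subsection \<open>Artinian reductions of points\<close>

text \<open>Since \<open>x\<^sub>z\<close> takes the value 1 at all points, a linear relation between the values of forms
  becomes, after multiplication with powers of \<open>x\<^sub>z\<close>, a relation modulo the vanishing ideal between
  forms of equal degree; its part not divisible by \<open>x\<^sub>z\<close> is a relation modulo \<open>I(X) + (x\<^sub>z)\<close>.\<close>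

lemma card_indep_mod_artinian_reduction_le:
  fixes Z :: "('v::finite \<Rightarrow> 'k::field) set"
  assumes Z: "finite Z" "\<forall>a\<in>Z. a z = 1"
    and S: "finite S" "\<And>b. b \<in> S \<Longrightarrow> \<exists>d. b \<in> forms d"
    and ind: "indep_mod (vanishing_ideal Z <+>\<^bsub>polyring\<^esub> PIdl\<^bsub>polyring\<^esub> (PVar z)) S"
      (is "indep_mod ?K S")
  shows "card S \<le> card Z"
proof (rule ccontr)
  assume "\<not> card S \<le> card Z"
  \<comment> \<open>The value vectors on \<open>Z\<close> are more numerous than the points, hence
    linearly dependent.\<close>
  then obtain c where c: "\<exists>b\<in>S. c b \<noteq> 0" "\<forall>a\<in>Z. (\<Sum>b\<in>S. c b * eval_at b a) = 0"
    using exists_nontrivial_solution[OF Z(1) S(1), of eval_at] by auto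
  obtain dg where dg: "\<forall>b\<in>S. b \<in> forms (dg b)"
    using bchoice[of S "\<lambda>b d. b \<in> forms d"] S(2) by blast
  define S' where "S' = {b \<in> S. c b \<noteq> 0}"
  define D where "D = Max (dg ` S')"
  have S': "finite S'" "S' \<noteq> {}" using S c(1) by (auto simp: S'_def)
  have le: "dg b \<le> D" if "b \<in> S'" for b
    unfolding D_def using S' that by simp
  have "D \<in> dg ` S'"
    unfolding D_def using S' by (intro Max_in) auto
  then obtain b0 where b0: "b0 \<in> S'" "dg b0 = D" by auto
  \<comment> \<open>\<open>D\<close> is the largest degree that occurs with nonzero coefficient. The
    powers of \<open>PVar z\<close> lift every term to degree \<open>D\<close> without changing its
    values on \<open>Z\<close>.\<close>
  define p where "p = (\<Sum>b\<in>S'. PConst (c b) * (PVar z ^ (D - dg b) * b))"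
  have "p \<in> forms D"
    unfolding p_def
  proof (intro forms_sum forms_PConst_mult)
    fix b assume "b \<in> S'"
    then have "PVar z ^ (D - dg b) * b \<in> forms ((D - dg b) * 1 + dg b)"
      using dg by (intro forms_mult forms_power forms_PVar) (auto simp: S'_def)
    then show "PVar z ^ (D - dg b) * b \<in> forms D"
      using le[OF \<open>b \<in> S'\<close>] by simp
  qed
  moreover have "eval_at p a = 0" if "a \<in> Z" for a
  proof -
    have "a z = 1" using that Z by blast
    then have "eval_at p a = (\<Sum>b\<in>S'. c b * eval_at b a)"
      by (simp add: p_def eval_at_sum)
    also have "\<dots> = (\<Sum>b\<in>S. c b * eval_at b a)"
      by (rule sum.mono_neutral_left) (auto simp: S'_def S(1))
    finally show ?thesis using c(2) that by simp
  qed
  ultimately have pI: "p \<in> vanishing_ideal Z"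
    by (simp add: form_in_vanishing_ideal_iff)
  \<comment> \<open>The terms outside \<open>T\<close> keep a positive power of
    \<open>PVar z\<close>, so modulo \<open>?K\<close> only \<open>T\<close> remains; it contains
    \<open>b0\<close>, whose coefficient is nonzero.\<close>
  define T where "T = {b \<in> S'. dg b = D}"
  have "\<exists>h. PConst (c b) * (PVar z ^ (D - dg b) * b) =
      (if b \<in> T then PConst (c b) * b else 0) + PVar z * h" if b: "b \<in> S'" for b
  proof (cases "dg b = D")
    case True
    then show ?thesis using b by (intro exI[of _ 0]) (simp add: T_def)
  next
    case False
    then obtain k where "D - dg b = Suc k"
      using le[OF b] by (metis Suc_diff_Suc le_neq_implies_less)
    then show ?thesis using False
      by (intro exI[of _ "PConst (c b) * (PVar z ^ k * b)"]) (simp add: T_def mult_ac)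
  qed
  then obtain h where h: "\<forall>b\<in>S'. PConst (c b) * (PVar z ^ (D - dg b) * b) =
      (if b \<in> T then PConst (c b) * b else 0) + PVar z * h b"
    using bchoice[of S' "\<lambda>b h. PConst (c b) * (PVar z ^ (D - dg b) * b) =
      (if b \<in> T then PConst (c b) * b else 0) + PVar z * h"] by blast
  have "p = (\<Sum>b\<in>S'. if b \<in> T then PConst (c b) * b else 0) + PVar z * (\<Sum>b\<in>S'. h b)"
    unfolding p_def sum_distrib_left sum.distrib[symmetric] using h by (intro sum.cong) auto
  also have "(\<Sum>b\<in>S'. if b \<in> T then PConst (c b) * b else 0) =
      (\<Sum>b\<in>S. PConst (if b \<in> T then c b else 0) * b)"
    by (rule sum.mono_neutral_cong_left) (auto simp: S'_def T_def S(1) PConst_def)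
  finally have "(\<Sum>b\<in>S. PConst (if b \<in> T then c b else 0) * b) = p + PVar z * (- (\<Sum>b\<in>S'. h b))"
    by simp
  then have "(\<Sum>b\<in>S. PConst (if b \<in> T then c b else 0) * b) \<in> ?K"
    unfolding set_add_PIdl_iff using pI by blast
  then have "\<forall>b\<in>S. (if b \<in> T then c b else 0) = 0"
    using ind unfolding indep_mod_def by (elim allE[of _ "\<lambda>b. if b \<in> T then c b else 0"]) simp
  then show False using b0 by (auto simp: T_def S'_def)
qed

text \<open>The basis in \<open>has_quot_dim\<close> may be inhomogeneous, while the preceding bound
  is about forms. A largest independent set of monomials spans modulo \<open>J\<close>, so it has at
  least \<open>r\<close> elements.\<close>

lemma obtain_monomial_basis:
  fixes J :: "('v::finite, 'k::field) mpoly set"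
  assumes J: "ideal J polyring" and dim: "has_quot_dim UNIV J r"
  obtains M where "finite M" "card M \<ge> r" "indep_mod J M" "M \<subseteq> range (\<lambda>m. Poly_Mapping.single m 1)"
proof -
  from dim obtain S where S: "finite S" "card S = r" "indep_mod J S"
    "\<And>p. \<exists>c. p - (\<Sum>b\<in>S. PConst (c b) * b) \<in> J"
    by (auto simp: has_quot_dim_def indep_mod_def)
  let ?Q = "\<lambda>M. finite M \<and> indep_mod J M \<and> M \<subseteq> range (\<lambda>m. Poly_Mapping.single m (1::'k))"
  have "?Q {}" by (simp add: indep_mod_def)
  have "\<forall>M. ?Q M \<longrightarrow> card M \<le> r"
    using indep_mod_card_le[OF J _ S(1)] S by blast
  then have "\<forall>M. ?Q M \<longrightarrow> card M < Suc r"
    by (simp add: less_Suc_eq_le)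
  with \<open>?Q {}\<close> have "\<exists>M. ?Q M \<and> (\<forall>M'. ?Q M' \<longrightarrow> card M' \<le> card M)"
    by (rule ex_has_greatest_nat)
  then obtain M where "?Q M \<and> (\<forall>M'. ?Q M' \<longrightarrow> card M' \<le> card M)" ..
  then have M: "?Q M" and max: "\<forall>M'. ?Q M' \<longrightarrow> card M' \<le> card M"
    by (rule conjunct1, rule conjunct2)
  have mon: "\<exists>c. Poly_Mapping.single m 1 - (\<Sum>b\<in>M. PConst (c b) * b) \<in> J" for m
  proof (rule ccontr)
    assume "\<not> ?thesis"
    then have "Poly_Mapping.single m 1 \<notin> M" "indep_mod J (insert (Poly_Mapping.single m 1) M)"
      using indep_mod_insert[OF J, of M "Poly_Mapping.single m 1"] M by blast+
    then show False
      using max[rule_format, of "insert (Poly_Mapping.single m 1) M"] M by simp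
  qed
  have "\<exists>C. \<forall>m. Poly_Mapping.single m 1 - (\<Sum>b\<in>M. PConst (C m b) * b) \<in> J"
    by (rule choice[of "\<lambda>m c. Poly_Mapping.single m 1 - (\<Sum>b\<in>M. PConst (c b) * b) \<in> J"])
       (rule allI, rule mon)
  then obtain C where C: "\<forall>m. Poly_Mapping.single m 1 - (\<Sum>b\<in>M. PConst (C m b) * b) \<in> J" ..
  \<comment> \<open>The monomials are spanned by \<open>M\<close> modulo \<open>J\<close>; their
    representations are combined with the coefficients of \<open>p\<close>.\<close>
  have span: "p - (\<Sum>b\<in>M. PConst (\<Sum>m\<in>Poly_Mapping.keys p. Poly_Mapping.lookup p m * C m b) * b) \<in> J"
    (is "p - ?c \<in> J") for p
  proof -
    let ?l = "Poly_Mapping.lookup p" and ?k = "Poly_Mapping.keys p"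
    have "?c = (\<Sum>m\<in>?k. PConst (?l m) * (\<Sum>b\<in>M. PConst (C m b) * b))"
      by (rule linear_combination_of_linear_combinations[symmetric])
    moreover have "p = (\<Sum>m\<in>?k. PConst (?l m) * Poly_Mapping.single m 1)"
      by (rule trans[OF poly_mapping_eq_sum_single]) simp
    ultimately have "p - ?c =
        (\<Sum>m\<in>?k. PConst (?l m) * Poly_Mapping.single m 1) -
        (\<Sum>m\<in>?k. PConst (?l m) * (\<Sum>b\<in>M. PConst (C m b) * b))"
      by (rule arg_cong2[rotated])
    also have "\<dots> = (\<Sum>m\<in>?k. PConst (?l m) * (Poly_Mapping.single m 1 - (\<Sum>b\<in>M. PConst (C m b) * b)))"
      by (simp only: right_diff_distrib sum_subtractf)
    also have "\<dots> \<in> J"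
      using J C by (intro ideal_sum) (auto simp: ideal_polyring_iff)
    finally show ?thesis .
  qed
  have "card S \<le> card M"
  proof (rule indep_mod_card_le[OF J S(1) _ S(3)])
    show "finite M" using M by blast
    show "\<exists>c. b - (\<Sum>t\<in>M. PConst (c t) * t) \<in> J" for b
      by (rule exI, rule span)
  qed
  with M S(2) show ?thesis by (intro that[of M]) auto
qed

text \<open>Otherwise \<open>J\<close> has a homogeneous element \<open>?g\<close> outside
  \<open>?K\<close>. Together with monomials independent modulo \<open>J\<close> it gives more than
  \<open>card Z\<close> forms independent modulo \<open>?K\<close>, against the bound above.\<close>

lemma artinian_reduction_eqI:
  fixes Z :: "('v::finite \<Rightarrow> 'k::field) set" and J :: "('v, 'k) mpoly set"
  assumes Z: "finite Z" "\<forall>a\<in>Z. a z = 1" and hom: "homogeneous_ideal J"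
    and dim: "has_quot_dim UNIV J (card Z)"
    and sub: "vanishing_ideal Z <+>\<^bsub>polyring\<^esub> PIdl\<^bsub>polyring\<^esub> (PVar z) \<subseteq> J" (is "?K \<subseteq> J")
  shows "J = ?K"
proof (rule ccontr)
  assume "J \<noteq> ?K"
  have J: "ideal J polyring" using hom by (simp add: homogeneous_ideal_def)
  have K: "ideal ?K polyring" by (intro ideal_set_add_PIdl ideal_vanishing_ideal)
  from sub \<open>J \<noteq> ?K\<close> obtain f where f: "f \<in> J" "f \<notin> ?K" by auto
  then obtain d where d: "hom_component d f \<notin> ?K"
    using sum_hom_component[of f] ideal_sum[OF K] by metis
  let ?g = "hom_component d f"
  have g: "?g \<in> J" using hom f by (simp add: homogeneous_ideal_def)
  obtain M where M: "finite M" "card M \<ge> card Z" "indep_mod J M"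
      "M \<subseteq> range (\<lambda>m. Poly_Mapping.single m 1)"
    using obtain_monomial_basis[OF J dim] .
  have MK: "indep_mod ?K M" using M(3) sub by (auto simp: indep_mod_def)
  have notin: "?g - (\<Sum>b\<in>M. PConst (c b) * b) \<notin> ?K" for c
  proof
    assume *: "?g - (\<Sum>b\<in>M. PConst (c b) * b) \<in> ?K"
    then have "?g - (\<Sum>b\<in>M. PConst (c b) * b) \<in> J"
      using sub by (rule rev_subsetD)
    from ideal_minus[OF J g this] have "\<forall>b\<in>M. c b = 0" using M(3) by (simp add: indep_mod_def)
    then have "(\<Sum>b\<in>M. PConst (c b) * b) = 0"
      by (intro sum.neutral) (simp add: PConst_def)
    then show False using * d by simp
  qed
  have "card (insert ?g M) \<le> card Z"
  proof (rule card_indep_mod_artinian_reduction_le[OF Z])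
    show "\<exists>d. b \<in> forms d" if "b \<in> insert ?g M" for b
      using that M(4) hom_component_forms[of d f] forms_single[OF refl] by blast
  qed (use M indep_mod_insert[OF K M(1) MK notin] in auto)
  then show False using M indep_mod_insert(1)[OF K M(1) MK notin] by simp
qed

section \<open>Descent of degrees and separators of points\<close>

lemma artinian_reduction_descent:
  fixes Z :: "('v::finite \<Rightarrow> 'k::field) set"
  assumes Z: "\<forall>a\<in>Z. a z = 1" and q: "q \<in> forms d"
    and K: "q \<in> vanishing_ideal Z <+>\<^bsub>polyring\<^esub> PIdl\<^bsub>polyring\<^esub> (PVar z)"
  shows "if d = 0 then \<forall>a\<in>Z. eval_at q a = 0
    else \<exists>p\<in>forms (d - 1). \<forall>a\<in>Z. eval_at p a = eval_at q a"
proof -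
  obtain g h where gh: "g \<in> vanishing_ideal Z" "q = g + PVar z * h"
    using K unfolding set_add_PIdl_iff by blast
  \<comment> \<open>Neither \<open>g\<close> nor \<open>h\<close> need be homogeneous, so components
    of degree \<open>d\<close> are compared. In degree 0 the multiple of \<open>PVar z\<close>
    contributes nothing.\<close>
  have "q = hom_component d g + (if 1 \<le> d then PVar z * hom_component (d - 1) h else 0)"
    using hom_component_of_form[OF q, of d] gh(2)
    by (simp add: hom_component_add hom_component_form_mult[OF forms_PVar])
  then have "eval_at q a = (if 1 \<le> d then eval_at (hom_component (d - 1) h) a else 0)" if "a \<in> Z" for a
    using that gh(1) Z by (auto simp: vanishing_ideal_iff eval_at_add)
  then show ?thesis
    using hom_component_forms[of "d - 1" h] by auto
qed

lemma exists_separator: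
  fixes Z :: "('v::finite \<Rightarrow> 'k::field) set"
  assumes Z: "finite Z" "\<forall>a\<in>Z. a z = 1" and a: "a \<in> Z"
  shows "\<exists>d. \<exists>q\<in>forms d. eval_at q a = 1 \<and> (\<forall>b\<in>Z - {a}. eval_at q b = 0)"
proof -
  have "\<exists>l\<in>forms 1. eval_at l a = 1 \<and> eval_at l b = 0" if b: "b \<in> Z - {a}" for b
  proof -
    from b have "a \<noteq> b" by auto
    then obtain v where v: "a v \<noteq> b v" by (auto simp: fun_eq_iff)
    \<comment> \<open>As \<open>a z = b z = 1\<close>, the bracket vanishes at \<open>b\<close> and
      has the value \<open>a v - b v\<close> at \<open>a\<close>. The separator is the product of
      these forms over all \<open>b\<close>.\<close>
    let ?l = "PConst (1 / (a v - b v)) * (PVar v - PConst (b v) * PVar z)"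
    have "?l \<in> forms 1"
      by (intro forms_PConst_mult forms_minus forms_PVar)
    moreover have "eval_at ?l a = 1" "eval_at ?l b = 0"
      using a b Z v by (simp_all add: eval_at_minus)
    ultimately show ?thesis by blast
  qed
  then obtain l where l: "\<forall>b\<in>Z - {a}. l b \<in> forms 1 \<and> eval_at (l b) a = 1 \<and> eval_at (l b) b = 0"
    using bchoice[of "Z - {a}" "\<lambda>b l. l \<in> forms 1 \<and> eval_at l a = 1 \<and> eval_at l b = 0"] by blast
  have "(\<Prod>b\<in>A. l b) \<in> forms (card A)" if "finite A" "A \<subseteq> Z - {a}" for A
    using that
  proof (induction A rule: finite_induct)
    case (insert x A)
    then have "l x * (\<Prod>b\<in>A. l b) \<in> forms (1 + card A)"
      using l by (intro forms_mult) auto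
    then show ?case using insert by simp
  qed (simp add: forms_one)
  then have "(\<Prod>b\<in>Z - {a}. l b) \<in> forms (card (Z - {a}))" using Z by simp
  moreover have "eval_at (\<Prod>b\<in>Z - {a}. l b) a = 1"
    using l by (simp add: eval_at_prod)
  moreover have "\<forall>b\<in>Z - {a}. eval_at (\<Prod>b\<in>Z - {a}. l b) b = 0"
    using l Z by (auto simp: eval_at_prod intro!: prod_zero)
  ultimately show ?thesis by blast
qed

lemma exists_separator_of_degree:
  fixes Z :: "('v::finite \<Rightarrow> 'k::field) set"
  assumes Z: "finite Z" "\<forall>a\<in>Z. a z = 1" and a: "a \<in> Z"
    and s: "\<And>t. t > s \<Longrightarrow> forms t \<subseteq> vanishing_ideal Z <+>\<^bsub>polyring\<^esub> PIdl\<^bsub>polyring\<^esub> (PVar z)"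
  shows "\<exists>q\<in>forms s. eval_at q a = 1 \<and> (\<forall>b\<in>Z - {a}. eval_at q b = 0)"
proof -
  let ?sep = "\<lambda>d. \<exists>q\<in>forms d. eval_at q a = 1 \<and> (\<forall>b\<in>Z - {a}. eval_at q b = 0)"
  have up: "?sep (d + k)" if "?sep d" for d k
  proof -
    from that obtain q where q: "q \<in> forms d" "eval_at q a = 1" "\<forall>b\<in>Z - {a}. eval_at q b = 0" by auto
    have "PVar z ^ k * q \<in> forms (k * 1 + d)"
      using q by (intro forms_mult forms_power forms_PVar)
    then show ?thesis
      using q a Z by (intro bexI[of _ "PVar z ^ k * q"]) (auto simp: add.commute)
  qed
  have down: "?sep (s + k) \<Longrightarrow> ?sep s" for k
  proof (induction k)
    case (Suc k)
    then obtain q where q: "q \<in> forms (s + Suc k)" "eval_at q a = 1" "\<forall>b\<in>Z - {a}. eval_at q b = 0"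
      by auto
    then have "q \<in> vanishing_ideal Z <+>\<^bsub>polyring\<^esub> PIdl\<^bsub>polyring\<^esub> (PVar z)"
      using s[of "s + Suc k"] by auto
    from artinian_reduction_descent[OF Z(2) q(1) this]
    obtain p where "p \<in> forms (s + k)" "\<forall>a\<in>Z. eval_at p a = eval_at q a" by auto
    then have "?sep (s + k)" using q a by (intro bexI[of _ p]) auto
    then show ?case by (rule Suc.IH)
  qed simp
  \<comment> \<open>The degree \<open>d\<close> may lie on either side of \<open>s\<close>: it is
    first raised to \<open>d + s\<close> and then lowered by \<open>d\<close> steps, each starting
    above \<open>s\<close>.\<close>
  obtain d where "?sep d" using exists_separator[OF Z a] by auto
  from up[OF this, of s] show ?thesis using down[of d] by (simp add: add.commute)
qed

text \<open>A separator of least degree works, since descent would produce one of smaller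
  degree.\<close>

lemma separator_notin_artinian_reduction:
  fixes Z :: "('v::finite \<Rightarrow> 'k::field) set"
  assumes Z: "finite Z" "\<forall>a\<in>Z. a z = 1" and a: "a \<in> Z"
  shows "\<exists>d. \<exists>q\<in>forms d. q \<notin> vanishing_ideal Z <+>\<^bsub>polyring\<^esub> PIdl\<^bsub>polyring\<^esub> (PVar z) \<and>
    (\<forall>b\<in>Z - {a}. eval_at q b = 0)"
proof -
  let ?sep = "\<lambda>d. \<exists>q\<in>forms d. eval_at q a = 1 \<and> (\<forall>b\<in>Z - {a}. eval_at q b = 0)"
  define d where "d = (LEAST d. ?sep d)"
  have "?sep d" unfolding d_def using exists_separator[OF Z a] by (rule LeastI_ex)
  then obtain q where q: "q \<in> forms d" "eval_at q a = 1" "\<forall>b\<in>Z - {a}. eval_at q b = 0" by auto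
  have "q \<notin> vanishing_ideal Z <+>\<^bsub>polyring\<^esub> PIdl\<^bsub>polyring\<^esub> (PVar z)"
  proof
    assume "q \<in> vanishing_ideal Z <+>\<^bsub>polyring\<^esub> PIdl\<^bsub>polyring\<^esub> (PVar z)"
    from artinian_reduction_descent[OF Z(2) q(1) this] q(2) a
    obtain p where p: "d \<noteq> 0" "p \<in> forms (d - 1)" "\<forall>a\<in>Z. eval_at p a = eval_at q a"
      by (auto split: if_splits)
    then have "?sep (d - 1)" using q a by (intro bexI[of _ p]) auto
    then have "d \<le> d - 1" unfolding d_def by (rule Least_le)
    then show False using p(1) by simp
  qed
  then show ?thesis using q by blast
qed

lemma apolar_sum_lin_form_power:
  fixes \<alpha> :: "nat \<Rightarrow> 'k::field_char_0"
  shows "apolar f (\<Sum>i\<in>A. PConst (\<alpha> i) * lin_form (P i) ^ s) =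
    fact s * (\<Sum>i\<in>A. \<alpha> i * eval_at (hom_component s f) (P i))"
  by (simp add: apolar_sum_PConst_right apolar_lin_form_power sum_distrib_left mult.left_commute)

text \<open>The ideal \<open>J\<close> determines its dual generator only up to a scalar. Uniqueness
  therefore compares decompositions of two generators \<open>F\<close> and \<open>F'\<close>, with
  one common factor \<open>c\<close>.\<close>

theorem proposition5p1:
  fixes z :: "'v::finite"
    and P :: "nat \<Rightarrow> 'v \<Rightarrow> 'k::{alg_closed_field, field_char_0}"
    and r s :: nat
    and J :: "('v, 'k) mpoly set"
    and F :: "('v, 'k) mpoly"
  assumes "CARD('v) \<ge> 2"
    and "\<forall>i\<in>{1..r}. P i z = 1"
    and "inj_on P {1..r}"
    and "arithmetically_gorenstein (P ` {1..r})"
    and "\<not> in_hyperplane (P ` {1..r})"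
    and "points_socle_degree (P ` {1..r}) s"
    and "homogeneous_ideal J"
    and "artinian_ring (polyring Quot J)"
    and "gorenstein_ring (polyring Quot J)"
    and "has_quot_dim UNIV J r"
    and "algebra_socle_degree J s"
    and "F \<in> forms s"
    and "perp J = gen_submodule F"
  shows "((J = vanishing_ideal (P ` {1..r}) <+>\<^bsub>polyring\<^esub> PIdl\<^bsub>polyring\<^esub> (PVar z)) \<longleftrightarrow>
         (\<exists>\<alpha> :: nat \<Rightarrow> 'k. (\<forall>i\<in>{1..r}. \<alpha> i \<noteq> 0) \<and>
            F = (\<Sum>i=1..r. PConst (\<alpha> i) * lin_form (P i) ^ s) \<and>
            (\<Sum>i=1..r. PConst (\<alpha> i) * lin_form (P i) ^ (s - 1)) = 0)) \<and>
         (\<forall>F' \<in> forms s. \<forall>\<alpha> \<beta> :: nat \<Rightarrow> 'k.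
           perp J = gen_submodule F' \<and>
           (\<forall>i\<in>{1..r}. \<alpha> i \<noteq> 0) \<and>
           F = (\<Sum>i=1..r. PConst (\<alpha> i) * lin_form (P i) ^ s) \<and>
           (\<Sum>i=1..r. PConst (\<alpha> i) * lin_form (P i) ^ (s - 1)) = 0 \<and>
           (\<forall>i\<in>{1..r}. \<beta> i \<noteq> 0) \<and>
           F' = (\<Sum>i=1..r. PConst (\<beta> i) * lin_form (P i) ^ s) \<and>
           (\<Sum>i=1..r. PConst (\<beta> i) * lin_form (P i) ^ (s - 1)) = 0 \<longrightarrow>
           (\<exists>c. c \<noteq> 0 \<and> (\<forall>i\<in>{1..r}. \<beta> i = c * \<alpha> i)))"
    (is "(?reduction \<longleftrightarrow> (\<exists>\<alpha>. ?decomposition \<alpha>)) \<and> ?uniqueness")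
proof -
  let ?I = "vanishing_ideal (P ` {1..r})"
  let ?K = "?I <+>\<^bsub>polyring\<^esub> PIdl\<^bsub>polyring\<^esub> (PVar z)"
  let ?S = "\<lambda>\<alpha> s. \<Sum>i=1..r. PConst (\<alpha> i) * lin_form (P i) ^ s"
  have J: "ideal J polyring"
    using assms(7) by (simp add: homogeneous_ideal_def)
  have top: "forms t \<subseteq> J" if "t > s" for t
    using assms(11) that by (simp add: algebra_socle_degree_def)
  have J_iff: "f \<in> J \<longleftrightarrow> (\<forall>h. apolar (h * f) F = 0)" for f
    using ideal_eq_annihilator[OF J top assms(13)] .
  have Z: "finite (P ` {1..r})" "\<forall>a\<in>P ` {1..r}. a z = 1"
    using assms(2) by auto
  have card: "card (P ` {1..r}) = r"
    using assms(3) by (simp add: card_image)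
  have Pz: "P i z = 1" if "i \<in> {1..r}" for i
    using assms(2) that by blast

  \<comment> \<open>Forms of degree \<open>s\<close> dual to the points; they serve both to find the
    coefficients and to compare them.\<close>
  have separators: "\<exists>q. \<forall>i\<in>{1..r}. q i \<in> forms s \<and> (\<forall>j\<in>{1..r}. eval_at (q i) (P j) = (if j = i then 1 else 0))"
    if "J = ?K"
  proof (rule bchoice, rule ballI)
    fix i assume i: "i \<in> {1..r}"
    obtain q where q: "q \<in> forms s" "eval_at q (P i) = 1" "\<forall>b\<in>P ` {1..r} - {P i}. eval_at q b = 0"
      using exists_separator_of_degree[OF Z, of "P i" s] top i unfolding \<open>J = ?K\<close> by blast
    have "eval_at q (P j) = 0" if "j \<in> {1..r}" "j \<noteq> i" for j
      using q(3) that i inj_onD[OF assms(3)] by blast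
    then show "\<exists>q. q \<in> forms s \<and> (\<forall>j\<in>{1..r}. eval_at q (P j) = (if j = i then 1 else 0))"
      using q by (intro exI[of _ q]) auto
  qed

  have reduction: "?reduction" if \<alpha>: "?decomposition \<alpha>" for \<alpha>
  proof -
    have F: "F = ?S \<alpha> s" and F0: "?S \<alpha> (s - 1) = 0" using \<alpha> by blast+
    have "?I \<subseteq> J"
    proof
      fix f assume "f \<in> ?I"
      then have "h * f \<in> ?I" for h
        using ideal_vanishing_ideal[of "P ` {1..r}"] by (simp add: ideal_polyring_iff)
      then show "f \<in> J"
        unfolding J_iff F apolar_sum_lin_form_power by (simp add: vanishing_ideal_iff)
    qed
    \<comment> \<open>Multiplying by \<open>PVar z\<close> moves the component of degree
      \<open>s - 1\<close> into degree \<open>s\<close> and preserves values at the points, so the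
      pairing with \<open>F\<close> is governed by the vanishing sum of powers
      \<open>s - 1\<close>.\<close>
    moreover have "PVar z \<in> J"
    proof -
      have "apolar (h * PVar z) F = 0" for h
      proof (cases "s = 0")
        \<comment> \<open>A multiple of \<open>PVar z\<close> has no component of degree 0.\<close>
        case True
        then show ?thesis
          unfolding F apolar_sum_lin_form_power mult.commute[of h]
            hom_component_form_mult[OF forms_PVar] by simp
      next
        case False
        have "(\<Sum>i=1..r. \<alpha> i * eval_at (hom_component (s - 1) h) (P i)) = 0"
          using apolar_sum_lin_form_power[of h \<alpha> P "s - 1" "{1..r}"] F0 by simp
        moreover have "apolar (h * PVar z) F =
            fact s * (\<Sum>i=1..r. \<alpha> i * eval_at (hom_component (s - 1) h) (P i))"
          unfolding F apolar_sum_lin_form_power mult.commute[of h]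
            hom_component_form_mult[OF forms_PVar] using False Pz by simp
        ultimately show ?thesis by simp
      qed
      then show ?thesis by (simp add: J_iff)
    qed
    ultimately have "g + h * PVar z \<in> J" if "g \<in> ?I" for g h
      using J that unfolding ideal_polyring_iff by blast
    then have "?K \<subseteq> J"
      by (auto simp: set_add_PIdl_iff mult.commute[of "PVar z"])
    then show ?reduction
      using artinian_reduction_eqI[OF Z assms(7)] assms(10) unfolding card by blast
  qed

  have decomposition: "\<exists>\<alpha>. ?decomposition \<alpha>" if red: ?reduction
  proof -
    obtain q where q: "\<And>i. i \<in> {1..r} \<Longrightarrow> q i \<in> forms s"
      "\<And>i j. i \<in> {1..r} \<Longrightarrow> j \<in> {1..r} \<Longrightarrow> eval_at (q i) (P j) = (if j = i then 1 else 0)"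
      using separators[OF red] by blast
    have "?I \<subseteq> J"
    proof
      fix f assume "f \<in> ?I"
      then show "f \<in> J" unfolding red set_add_PIdl_iff by (intro exI[of _ f] exI[of _ 0]) simp
    qed
    have zJ: "PVar z \<in> J"
      unfolding red set_add_PIdl_iff using ideal_vanishing_ideal[of "P ` {1..r}"]
      by (intro exI[of _ 0] exI[of _ 1]) (simp add: ideal_polyring_iff)
    define \<alpha> where "\<alpha> i = apolar (q i) F / fact s" for i
    have form: "apolar f F = fact s * (\<Sum>i=1..r. \<alpha> i * eval_at f (P i))" if f: "f \<in> forms s" for f
    proof -
      \<comment> \<open>Lagrange interpolation: \<open>f\<close> and \<open>?g\<close> agree on all
        points, so their difference lies in \<open>?I\<close> and pairs to 0 with
        \<open>F\<close>.\<close>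
      let ?g = "\<Sum>i=1..r. PConst (eval_at f (P i)) * q i"
      have "f - ?g \<in> forms s"
        using f q(1) by (intro forms_minus forms_sum forms_PConst_mult) auto
      moreover have "eval_at (f - ?g) (P j) = 0" if "j \<in> {1..r}" for j
      proof -
        have "eval_at ?g (P j) = (\<Sum>i=1..r. if j = i then eval_at f (P i) else 0)"
          unfolding eval_at_sum by (rule sum.cong) (use q(2) that in auto)
        then show ?thesis using that by (simp add: eval_at_minus)
      qed
      ultimately have "f - ?g \<in> ?I" by (auto simp: form_in_vanishing_ideal_iff)
      with \<open>?I \<subseteq> J\<close> have "apolar (1 * (f - ?g)) F = 0" using J_iff by blast
      then show ?thesis
        by (simp add: apolar_minus_left apolar_sum_left apolar_PConst_left \<alpha>_def sum_distrib_left
            mult.commute[of "apolar _ _"])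
    qed
    have F: "F = ?S \<alpha> s"
    proof (rule apolar_eqI)
      fix m :: "'v \<Rightarrow>\<^sub>0 nat"
      let ?m = "Poly_Mapping.single m (1::'k)"
      have "apolar ?m F = apolar (hom_component s ?m) F"
        by (rule apolar_hom_component[symmetric, OF assms(12)])
      then show "apolar ?m F = apolar ?m (?S \<alpha> s)"
        by (simp only: apolar_sum_lin_form_power form[OF hom_component_forms])
    qed
    \<comment> \<open>Excludes that \<open>s - 1\<close> is truncated. In degree 0 the separators
      are constants, which leaves at most one point, and then a hyperplane contains \<open>X\<close>
      because there are two variables.\<close>
    have "s \<noteq> 0"
    proof
      assume "s = 0"
      have "r \<le> 1"
      proof (rule ccontr)
        assume "\<not> r \<le> 1"
        then have r: "1 \<in> {1..r}" "2 \<in> {1..r}" by auto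
        have "eval_at (q 1) a = Poly_Mapping.lookup (q 1) 0" for a
        proof -
          have "Poly_Mapping.keys (q 1) \<subseteq> {0}"
            using q(1)[OF r(1)] \<open>s = 0\<close> by (auto simp: forms_def mon_deg_def intro: poly_mapping_eqI)
          then show ?thesis
            unfolding eval_at_eq_lin_ext by (subst lin_ext_superset[of "{0}"]) auto
        qed
        then show False using q(2)[OF r(1) r(1)] q(2)[OF r(1) r(2)] by simp
      qed
      have "\<exists>v. v \<noteq> z"
      proof (rule ccontr)
        assume "\<nexists>v. v \<noteq> z"
        then have "UNIV = {z}" by auto
        then have "CARD('v) = 1" by (metis card.empty card_insert_disjoint empty_iff finite.emptyI One_nat_def)
        then show False using assms(1) by simp
      qed
      then obtain v where v: "v \<noteq> z" by blast
      \<comment> \<open>Vanishes at \<open>P 1\<close>, whose coordinate \<open>z\<close> is 1 if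
        \<open>r = 1\<close>; for \<open>r = 0\<close> there is no point to check.\<close>
      let ?l = "PVar v - PConst (P 1 v) * PVar z"
      have "?l \<in> forms 1" by (intro forms_minus forms_PConst_mult forms_PVar)
      moreover have single_ne: "Poly_Mapping.single z (1::nat) \<noteq> Poly_Mapping.single v 1"
        using v by (metis lookup_single_eq lookup_single_not_eq zero_neq_one)
      then have "Poly_Mapping.lookup ?l (Poly_Mapping.single v 1) = 1"
        by (simp add: lookup_minus) (simp add: PVar_def lookup_single when_def)
      then have "?l \<noteq> 0" by (metis lookup_zero zero_neq_one)
      moreover have "\<forall>a\<in>P ` {1..r}. eval_at ?l a = 0"
      proof
        fix a assume "a \<in> P ` {1..r}"
        then obtain i where "i \<in> {1..r}" "a = P i" by blast
        moreover from this have "i = 1" using \<open>r \<le> 1\<close> by auto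
        ultimately have "a = P 1" "a z = 1" using Pz by auto
        then show "eval_at ?l a = 0" by (simp add: eval_at_minus)
      qed
      ultimately show False using assms(5) by (auto simp: in_hyperplane_def)
    qed
    \<comment> \<open>Pairing this sum with a monomial agrees, up to a nonzero factorial, with
      pairing \<open>F\<close> with the monomial times \<open>PVar z\<close>, which is an element of
      \<open>J\<close>.\<close>
    have "?S \<alpha> (s - 1) = 0"
    proof (rule apolar_eqI)
      fix m :: "'v \<Rightarrow>\<^sub>0 nat"
      let ?m = "Poly_Mapping.single m (1::'k)"
      have "0 = apolar (?m * PVar z) F" using zJ J_iff by simp
      also have "\<dots> = fact s * (\<Sum>i=1..r. \<alpha> i * eval_at (hom_component (s - 1) ?m) (P i))"
        unfolding F apolar_sum_lin_form_power mult.commute[of ?m]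
          hom_component_form_mult[OF forms_PVar]
        using \<open>s \<noteq> 0\<close> Pz by simp
      finally have "(\<Sum>i=1..r. \<alpha> i * eval_at (hom_component (s - 1) ?m) (P i)) = 0" by simp
      then show "apolar ?m (?S \<alpha> (s - 1)) = apolar ?m 0"
        by (simp add: apolar_sum_lin_form_power)
    qed
    moreover have "\<alpha> i \<noteq> 0" if i: "i \<in> {1..r}" for i
    proof
      assume "\<alpha> i = 0"
      obtain d p where p: "p \<in> forms d" "p \<notin> J" "\<forall>b\<in>P ` {1..r} - {P i}. eval_at p b = 0"
        using separator_notin_artinian_reduction[OF Z, of "P i"] i unfolding red by blast
      \<comment> \<open>The components of \<open>h * p\<close> vanish at every point other than
        \<open>P i\<close>, and the term at \<open>P i\<close> has coefficient 0. Hence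
        \<open>p\<close> would annihilate \<open>F\<close> and lie in \<open>J\<close>.\<close>
      have "apolar (h * p) F = 0" for h
      proof -
        have "\<alpha> j * eval_at (hom_component s (h * p)) (P j) = 0" if "j \<in> {1..r}" for j
        proof (cases "j = i")
          case False
          then have "eval_at p (P j) = 0"
            using p(3) that i inj_onD[OF assms(3)] by blast
          then show ?thesis
            by (simp add: mult.commute[of h] hom_component_form_mult[OF p(1)])
        qed (simp add: \<open>\<alpha> i = 0\<close>)
        then show ?thesis unfolding F apolar_sum_lin_form_power by (simp add: sum.neutral del: mult_eq_0_iff)
      qed
      then show False using p(2) J_iff by blast
    qed
    ultimately show ?thesis using F by blast
  qed

  have ?uniqueness
  proof (intro ballI allI impI, elim conjE)
    fix F' \<alpha> \<beta>
    assume F': "perp J = gen_submodule F'" and F'_eq: "F' = ?S \<beta> s" and \<beta>: "\<forall>i\<in>{1..r}. \<beta> i \<noteq> 0"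
      and \<alpha>: "\<forall>i\<in>{1..r}. \<alpha> i \<noteq> 0" "F = ?S \<alpha> s" "?S \<alpha> (s - 1) = 0"
    obtain q where q: "\<And>i. i \<in> {1..r} \<Longrightarrow> q i \<in> forms s"
      "\<And>i j. i \<in> {1..r} \<Longrightarrow> j \<in> {1..r} \<Longrightarrow> eval_at (q i) (P j) = (if j = i then 1 else 0)"
      using separators reduction \<alpha> by blast
    have "F' \<in> gen_submodule F"
      using self_in_gen_submodule[of F'] F' assms(13) by simp
    then obtain h where h: "F' = diff_act h F" by (auto simp: gen_submodule_def)
    \<comment> \<open>\<open>F\<close> and \<open>F'\<close> have the same degree, so only the
      constant term of \<open>h\<close> matters: the component of \<open>q i * h\<close> in degree
      \<open>s\<close> is \<open>?c\<close> times \<open>q i\<close>.\<close>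
    let ?c = "Poly_Mapping.lookup h 0"
    have "hom_component 0 h = PConst ?c"
    proof (rule poly_mapping_eqI)
      fix m :: "'v \<Rightarrow>\<^sub>0 nat"
      have "mon_deg m = 0 \<longleftrightarrow> m = 0"
        by (auto simp: mon_deg_def intro: poly_mapping_eqI)
      then show "Poly_Mapping.lookup (hom_component 0 h) m = Poly_Mapping.lookup (PConst ?c) m"
        by (auto simp: lookup_hom_component PConst_def lookup_single when_def)
    qed
    have \<beta>_eq: "\<beta> i = ?c * \<alpha> i" if i: "i \<in> {1..r}" for i
    proof -
      have delta: "(\<Sum>j=1..r. \<gamma> j * eval_at (q i) (P j)) = \<gamma> i" for \<gamma> :: "nat \<Rightarrow> 'k"
      proof -
        have "(\<Sum>j=1..r. \<gamma> j * eval_at (q i) (P j)) = (\<Sum>j=1..r. if j = i then \<gamma> j else 0)"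
          using q(2)[OF i] by (intro sum.cong) auto
        then show ?thesis using i by simp
      qed
      have "fact s * \<beta> i = apolar (q i) F'"
        unfolding F'_eq apolar_sum_lin_form_power hom_component_of_form[OF q(1)[OF i]]
        by (simp only: delta refl if_True)
      also have "\<dots> = apolar (q i * h) F"
        by (simp add: h apolar_diff_act)
      also have "\<dots> = fact s * (\<Sum>j=1..r. (?c * \<alpha> j) * eval_at (q i) (P j))"
        unfolding \<alpha>(2) apolar_sum_lin_form_power hom_component_form_mult[OF q(1)[OF i]]
        by (simp add: \<open>hom_component 0 h = PConst ?c\<close> mult_ac)
      also have "\<dots> = fact s * (?c * \<alpha> i)"
        by (simp only: delta)
      finally show ?thesis by simp
    qed
    show "\<exists>c. c \<noteq> 0 \<and> (\<forall>i\<in>{1..r}. \<beta> i = c * \<alpha> i)"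
    \<comment> \<open>Without points any nonzero factor will do; otherwise \<open>?c\<close> is
      nonzero because \<open>\<beta> 1\<close> is.\<close>
    proof (cases "r = 0")
      case True
      then show ?thesis by (intro exI[of _ 1]) simp
    next
      case False
      then have "?c \<noteq> 0" using \<beta> \<beta>_eq[of 1] by auto
      then show ?thesis using \<beta>_eq by blast
    qed
  qed
  then show ?thesis using reduction decomposition by blast
qed

end
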